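(* Let $d,m\ge 1$ be integers, $\hat\alpha=(\alpha_1,\dots,\alpha_d)\in(0,1]^d$, $r_j>0$ for $1\le j\le m$, $r=\max_{1\le j\le m} r_j$, and let $\tau_j:[0,\infty)\to[0,r_j]$ be continuous for $1\le j\le m$. Let $f:\mathbb{R}^d\to\mathbb{R}^d$ be cooperative and homogeneous of degree $p\ge 1$. For $1\le j\le m$ let $g^{(j)}:\mathbb{R}^d\to\mathbb{R}^d$ be continuous on $\mathbb{R}^d$, continuously differentiable on $\mathbb{R}^d\setminus\{0\}$, order-preserving on $\mathbb{R}^d_{\ge 0}$, and homogeneous of the same degree $q_j=p$. Suppose there exists a vector $v\succ 0$ with $f(v)+\sum_{j=1}^m g^{(j)}(v)\prec 0$. Consider the system $$ {}^{C}D^{\hat\alpha}_{0^+}w(t)=f(w(t))+\sum_{j=1}^m g^{(j)}(w(t-\tau_j(t))),\ t>0,\qquad w(s)=\varphi(s),\ s\in[-r,0], $$ with initial conditions $\varphi\in C([-r,0];\mathbb{R}^d_{\ge0})$, and denote its solution by $\Phi(\cdot,\varphi)$. Then the trivial solution is globally Mittag-Leffler stable: there exists $\beta>0$ such that for every $\varphi\in C([-r,0];\mathbb{R}^d_{\ge 0})$ the solution $\Phi(\cdot,\varphi)$ exists on $[0,\infty)$ and there are constants $c,\nu>0$ (which may depend on $\varphi$ and on the data of the system) with $$ \|\Phi(t,\varphi)\|\le \nu\,E_\beta(-c\,t^\beta)\quad\text{for all } t\ge 0 . $$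
   Context: Order on $\mathbb{R}^d$: $u\preceq w$ (equivalently $w\succeq u$) means $u_i\le w_i$ for all $i$; $u\prec w$ (equivalently $w\succ u$) means $u_i<w_i$ for all $i$. $\mathbb{R}^d_{\ge0}=\{x\in\mathbb{R}^d: x\succeq 0\}$. $\|\cdot\|$ is the Euclidean norm on $\mathbb{R}^d$. A vector field $f:\mathbb{R}^d\to\mathbb{R}^d$ is cooperative if it is continuous on $\mathbb{R}^d$, continuously differentiable on $\mathbb{R}^d\setminus\{0\}$, and its Jacobian matrix $Df(x)$ is Metzler (all off-diagonal entries nonnegative) for every $x\in\mathbb{R}^d_{\ge0}\setminus\{0\}$. A vector field $h$ is homogeneous of degree $p$ if $h(\lambda x)=\lambda^p h(x)$ for all $x\in\mathbb{R}^d$, $\lambda>0$. $h$ is order-preserving on $\mathbb{R}^d_{\ge0}$ if $h(u)\succeq h(v)$ whenever $u,v\in\mathbb{R}^d_{\ge0}$ and $u\succeq v$. Fractional calculus: for $\alpha>0$, $I^{\alpha}_{0^+}x(t)=\frac1{\Gamma(\alpha)}\int_0^t(t-s)^{\alpha-1}x(s)\,ds$, with $I^0_{0^+}$ the identity. For $\alpha\in(0,1]$, the Caputo derivative is ${}^{C}D^{\alpha}_{0^+}x(t)=\frac{d}{dt}I^{1-\alpha}_{0^+}(x(\cdot)-x(0))(t)$, $t>0$ (for $\alpha=1$ it is the ordinary derivative). For $\hat\alpha=(\alpha_1,\dots,\alpha_d)$ and $w=(w_1,\dots,w_d)^{\rm T}$, ${}^{C}D^{\hat\alpha}_{0^+}w(t)=({}^{C}D^{\alpha_1}_{0^+}w_1(t),\dots,{}^{C}D^{\alpha_d}_{0^+}w_d(t))^{\rm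 T}$. The Mittag-Leffler function is $E_\beta(x)=\sum_{k=0}^\infty \frac{x^k}{\Gamma(\beta k+1)}$, $x\in\mathbb{R}$, $\beta>0$. For each continuous initial function $\varphi$, the system has a unique continuous solution $\Phi(\cdot,\varphi)$ on a maximal interval of existence $[0,T_{\max}(\varphi))$ (extended by $\varphi$ on $[-r,0]$). The trivial solution is the zero solution. *)

theory Defs
  imports "HOL-Analysis.Analysis"
begin

text \<open>
  The library order \<open>\<le>\<close> on \<^typ>\<open>real ^ 'n\<close> is the componentwise one. The library's \<open><\<close> on this
  type is only its strict part, so the componentwise strict order needs its own constant.
\<close>

definition vec_prec :: "real ^ 'n \<Rightarrow> real ^ 'n \<Rightarrow> bool" (infix \<open>\<prec>\<close> 50) where
  "u \<prec> w \<longleftrightarrow> (\<forall>i. u $ i < w $ i)"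

definition C1_away_from_0 :: "(real ^ 'n \<Rightarrow> real ^ 'n) \<Rightarrow> bool" where
  "C1_away_from_0 h \<longleftrightarrow>
     (\<forall>x. x \<noteq> 0 \<longrightarrow> h differentiable (at x)) \<and>
     continuous_on (- {0}) (\<lambda>x. jacobian h (at x))"

definition metzler :: "real ^ 'n ^ 'n \<Rightarrow> bool" where
  "metzler A \<longleftrightarrow> (\<forall>i j. i \<noteq> j \<longrightarrow> A $ i $ j \<ge> 0)"

definition cooperative :: "(real ^ 'n \<Rightarrow> real ^ 'n) \<Rightarrow> bool" where
  "cooperative f \<longleftrightarrow>
     continuous_on UNIV f \<and> C1_away_from_0 f \<and>
     (\<forall>x. 0 \<le> x \<and> x \<noteq> 0 \<longrightarrow> metzler (jacobian f (at x)))"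

definition homogeneous :: "real \<Rightarrow> (real ^ 'n \<Rightarrow> real ^ 'n) \<Rightarrow> bool" where
  "homogeneous p h \<longleftrightarrow> (\<forall>x. \<forall>l>0. h (l *\<^sub>R x) = (l powr p) *\<^sub>R h x)"

definition order_preserving :: "(real ^ 'n \<Rightarrow> real ^ 'n) \<Rightarrow> bool" where
  "order_preserving h \<longleftrightarrow> (\<forall>u v. 0 \<le> u \<and> 0 \<le> v \<and> v \<le> u \<longrightarrow> h v \<le> h u)"

definition frac_integral :: "real \<Rightarrow> (real \<Rightarrow> real) \<Rightarrow> real \<Rightarrow> real" where
  "frac_integral \<alpha> x t =
     (if \<alpha> = 0 then x t
      else 1 / Gamma \<alpha> * (LINT s:{0..t}|lborel. (t - s) powr (\<alpha> - 1) * x s))"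

text \<open>
  \<open>has_caputo_derivative \<alpha> x D t\<close>: the Caputo derivative of order \<open>\<alpha>\<close> of \<open>x\<close> exists at \<open>t\<close> and
  equals \<open>D\<close>.
\<close>

definition has_caputo_derivative :: "real \<Rightarrow> (real \<Rightarrow> real) \<Rightarrow> real \<Rightarrow> real \<Rightarrow> bool" where
  "has_caputo_derivative \<alpha> x D t \<longleftrightarrow>
     ((\<lambda>u. frac_integral (1 - \<alpha>) (\<lambda>s. x s - x 0) u) has_real_derivative D) (at t)"

definition mittag_leffler :: "real \<Rightarrow> real \<Rightarrow> real" where
  "mittag_leffler \<beta> x = (\<Sum>k. x ^ k / Gamma (\<beta> * real k + 1))"

text \<open>
  Continuous solutions on \<open>[-r, T)\<close>, with \<open>0 < T \<le> \<infinity>\<close>. The values of \<open>w\<close> outside this interval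
  are irrelevant.
\<close>

definition is_solution ::
  "real ^ 'n \<Rightarrow> (real ^ 'n \<Rightarrow> real ^ 'n) \<Rightarrow> nat \<Rightarrow> (nat \<Rightarrow> real ^ 'n \<Rightarrow> real ^ 'n) \<Rightarrow>
   (nat \<Rightarrow> real \<Rightarrow> real) \<Rightarrow> real \<Rightarrow> (real \<Rightarrow> real ^ 'n) \<Rightarrow> ereal \<Rightarrow> (real \<Rightarrow> real ^ 'n) \<Rightarrow> bool" where
  "is_solution \<alpha> f m g \<tau> r \<phi> T w \<longleftrightarrow>
     0 < T \<and>
     continuous_on {t. - r \<le> t \<and> ereal t < T} w \<and>
     (\<forall>s\<in>{- r..0}. w s = \<phi> s) \<and>
     (\<forall>t>0. ereal t < T \<longrightarrow>
        (\<forall>i. has_caputo_derivative (\<alpha> $ i) (\<lambda>s. w s $ i)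
               ((f (w t) + (\<Sum>j=1..m. g j (w (t - \<tau> j t)))) $ i) t))"

text \<open>
  \<open>w\<close> on \<open>[-r, T)\<close> is the unique solution on its maximal interval of existence: every solution
  is a restriction of it.
\<close>

definition is_maximal_solution ::
  "real ^ 'n \<Rightarrow> (real ^ 'n \<Rightarrow> real ^ 'n) \<Rightarrow> nat \<Rightarrow> (nat \<Rightarrow> real ^ 'n \<Rightarrow> real ^ 'n) \<Rightarrow>
   (nat \<Rightarrow> real \<Rightarrow> real) \<Rightarrow> real \<Rightarrow> (real \<Rightarrow> real ^ 'n) \<Rightarrow> ereal \<Rightarrow> (real \<Rightarrow> real ^ 'n) \<Rightarrow> bool" where
  "is_maximal_solution \<alpha> f m g \<tau> r \<phi> T w \<longleftrightarrow>
     is_solution \<alpha> f m g \<tau> r \<phi> T w \<and>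
     (\<forall>T' w'. is_solution \<alpha> f m g \<tau> r \<phi> T' w' \<longrightarrow>
        T' \<le> T \<and> (\<forall>t. - r \<le> t \<and> ereal t < T' \<longrightarrow> w' t = w t))"

end

theory Submission
  imports Defs
begin

text \<open>
  Let \<open>z t = (A + t) powr (- \<gamma>)\<close>, where \<open>\<gamma> * p\<close> is smaller than all orders \<open>\<alpha>\<^sub>i\<close>. By homogeneity the
  right-hand side of the system along \<open>K * z t * v\<close> is close to \<open>(K * z t) powr p\<close> times
  \<open>f v + (\<Sum>j. g j v)\<close>, a negative vector, because bounded delays hardly change \<open>z\<close> when \<open>A\<close> is large.
  The Caputo derivatives of \<open>z\<close> are only of size \<open>t powr (- \<alpha>\<^sub>i)\<close>, with a factor that vanishes as \<open>A\<close>
  grows, so \<open>K z v\<close> is a strict supersolution for every \<open>K \<ge> 1\<close> (\<open>barrier_supersolution\<close>). For large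
  \<open>K\<close> it lies above the initial function. Cooperativity and monotonicity then trap the solution
  between \<open>0\<close> and \<open>K z v\<close>, and a power \<open>(1 + t) powr (- \<gamma>)\<close> with \<open>\<gamma> < 1\<close> is at most a multiple of
  \<open>E\<^sub>\<gamma>(- c t\<^sup>\<gamma>)\<close> for small \<open>c\<close> (\<open>mittag_leffler_lower_bound\<close>). So \<open>\<beta> = \<gamma>\<close> works for all initial
  functions.

  All comparisons, including the one for the Mittag-Leffler function, rest on one scalar principle
  (\<open>frac_comparison\<close>): if \<open>y = y0 + I\<^sup>a D\<close> with \<open>y0 \<ge> 0\<close> and \<open>D > 0\<close> wherever \<open>y = 0\<close>, then \<open>y \<ge> 0\<close>.
  Solutions are only continuous, so pointwise formulas for the Caputo derivative at a touching point
  are not at hand. Instead \<open>frac_restart\<close> shows, with the semigroup law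
  \<open>I\<^sup>a I\<^sup>b = I\<^sup>a\<^sup>+\<^sup>b\<close> and monotonicity alone, that a nonnegative past only helps: after any time \<open>c\<close>
  the function \<open>y\<close> lies above the fractional integral of \<open>D\<close> started at \<open>c\<close>.

  Existence uses the same box. Clamping the state to it makes the right-hand side bounded and
  globally Lipschitz, so a weighted contraction gives a solution on the whole half-line
  (\<open>volterra_exists\<close>), and the comparison shows that the clamping was never active. Degree \<open>p \<ge> 1\<close>
  makes the vector fields Lipschitz on bounded sets, across the origin too
  (\<open>homogeneous_lipschitz\<close>), which gives uniqueness.
\<close>

section \<open>Riemann--Liouville integrals\<close>

definition frac_integrable :: "real \<Rightarrow> (real \<Rightarrow> real) \<Rightarrow> real \<Rightarrow> bool" where
  "frac_integrable a x t \<longleftrightarrow> set_integrable lborel {0..t} (\<lambda>s. (t - s) powr (a - 1) * x s)"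

lemma frac_integral_0 [simp]: "frac_integral 0 x t = x t"
  by (simp add: frac_integral_def)

lemma frac_integral_zero [simp]:
  assumes "a > 0" shows "frac_integral a x 0 = 0"
proof -
  have "indicator {0..0::real} s *\<^sub>R ((0 - s) powr (a - 1) * x s) = 0" for s :: real
    by (auto simp: indicator_def)
  then have "(LINT s:{0..0}|lborel. (0 - s) powr (a - 1) * x s) = 0"
    unfolding set_lebesgue_integral_def by (simp only:) simp
  then show ?thesis using assms by (simp add: frac_integral_def)
qed

lemma frac_integral_cong:
  assumes "t \<ge> 0" "\<And>s. 0 \<le> s \<Longrightarrow> s \<le> t \<Longrightarrow> x s = y s"
  shows "frac_integral a x t = frac_integral a y t"
proof -
  have "(LINT s:{0..t}|lborel. (t - s) powr (a - 1) * x s)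
      = (LINT s:{0..t}|lborel. (t - s) powr (a - 1) * y s)"
    by (rule set_lebesgue_integral_cong) (use assms in auto)
  then show ?thesis using assms by (simp add: frac_integral_def)
qed

text \<open>
  Rescaling to the unit interval freezes the singular kernel: continuity and monotonicity in \<open>t\<close>
  can then be read off the integrand.
\<close>

lemma frac_integral_scaled:
  assumes "a > 0" "t \<ge> 0"
  shows "frac_integral a x t =
    t powr a / Gamma a * (LINT s:{0..1}|lborel. (1 - s) powr (a - 1) * x (t * s))"
proof (cases "t = 0")
  case True
  then show ?thesis using assms by simp
next
  case False
  with assms have t: "t > 0" by simp
  have "(LINT s:{0..t}|lborel. (t - s) powr (a - 1) * x s)
      = t * (\<integral>s. indicator {0..t} (t * s) * ((t - t * s) powr (a - 1) * x (t * s)) \<partial>lborel)"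
    unfolding set_lebesgue_integral_def
    using t by (subst lborel_integral_real_affine[where c = t and t = 0]) auto
  also have "(\<integral>s. indicator {0..t} (t * s) * ((t - t * s) powr (a - 1) * x (t * s)) \<partial>lborel)
      = (\<integral>s. t powr (a - 1) * (indicator {0..1} s * ((1 - s) powr (a - 1) * x (t * s))) \<partial>lborel)"
  proof (rule Bochner_Integration.integral_cong)
    fix s :: real
    show "indicator {0..t} (t * s) * ((t - t * s) powr (a - 1) * x (t * s))
        = t powr (a - 1) * (indicator {0..1} s * ((1 - s) powr (a - 1) * x (t * s)))"
    proof (cases "s \<in> {0..1}")
      case True
      have "t - t * s = t * (1 - s)" by (simp add: algebra_simps)
      then have "(t - t * s) powr (a - 1) = t powr (a - 1) * (1 - s) powr (a - 1)"
        using True t by (simp add: powr_mult)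
      then show ?thesis using True t by (simp add: mult_left_le)
    qed (use t in \<open>auto simp: indicator_def zero_le_mult_iff mult_le_cancel_left1\<close>)
  qed simp
  also have "\<dots> = t powr (a - 1) * (LINT s:{0..1}|lborel. (1 - s) powr (a - 1) * x (t * s))"
    by (simp add: set_lebesgue_integral_def)
  also have "t * (t powr (a - 1) * (LINT s:{0..1}|lborel. (1 - s) powr (a - 1) * x (t * s)))
      = t powr a * (LINT s:{0..1}|lborel. (1 - s) powr (a - 1) * x (t * s))"
    using t by (simp add: powr_diff)
  finally show ?thesis using assms by (simp add: frac_integral_def)
qed

lemma frac_powr:
  assumes "a > 0" "b > 0" "t \<ge> 0"
  shows frac_integrable_powr: "frac_integrable a (\<lambda>s. s powr (b - 1)) t"
    and frac_integral_powr: "frac_integral a (\<lambda>s. s powr (b - 1)) t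
           = Gamma b / Gamma (a + b) * t powr (a + b - 1)"
proof -
  have int: "set_integrable lborel {0..1} (\<lambda>s::real. (1 - s) powr (a - 1) * s powr (b - 1))"
    using integrable_Beta[OF assms(2,1)] by (simp add: mult.commute)
  have val: "(LINT s:{0..1}|lborel. (1 - s) powr (a - 1) * s powr (b - 1)) = Beta a b"
    using has_integral_Beta_real[OF assms(2,1)] set_borel_integral_eq_integral(2)[OF int]
    by (simp add: mult.commute Beta_commute integral_unique)
  have scale: "(1 - s) powr (a - 1) * (t * s) powr (b - 1)
       = t powr (b - 1) * ((1 - s) powr (a - 1) * s powr (b - 1))" if "s \<in> {0..1}" for s :: real
    using that assms by (simp add: powr_mult)
  show "frac_integral a (\<lambda>s. s powr (b - 1)) t = Gamma b / Gamma (a + b) * t powr (a + b - 1)"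
  proof (cases "t = 0")
    case False
    have "(LINT s:{0..1}|lborel. (1 - s) powr (a - 1) * (t * s) powr (b - 1))
        = (LINT s:{0..1}|lborel. t powr (b - 1) * ((1 - s) powr (a - 1) * s powr (b - 1)))"
      by (rule set_lebesgue_integral_cong) (use scale in auto)
    also have "\<dots> = t powr (b - 1) * Beta a b" using val by simp
    finally have "frac_integral a (\<lambda>s. s powr (b - 1)) t
        = t powr a / Gamma a * (t powr (b - 1) * Beta a b)"
      using frac_integral_scaled[OF assms(1,3)] by simp
    then show ?thesis
      using Gamma_real_pos[OF assms(1)] by (simp add: Beta_def powr_add powr_diff field_simps)
  qed (use assms in simp)
  show "frac_integrable a (\<lambda>s. s powr (b - 1)) t"
  proof (cases "t = 0")
    case True
    have "indicator {0..0::real} s *\<^sub>R ((0 - s) powr (a - 1) * s powr (b - 1)) = 0" for s :: real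
      by (auto simp: indicator_def)
    then show ?thesis
      using True unfolding frac_integrable_def set_integrable_def by (simp only:) simp
  next
    case False
    with assms have t: "t > 0" by simp
    have "integrable lborel (\<lambda>s. indicator {0..1} s *\<^sub>R ((1 - s) powr (a - 1) * s powr (b - 1)))"
      using int by (simp add: set_integrable_def)
    then have "integrable lborel (\<lambda>s. t powr (a + b - 2) * (indicator {0..1} (0 + (1/t) * s)
        * ((1 - (0 + (1/t) * s)) powr (a - 1) * (0 + (1/t) * s) powr (b - 1))))"
      using t by (subst lborel_integrable_real_affine_iff) auto
    also have "(\<lambda>s. t powr (a + b - 2) * (indicator {0..1} (0 + (1/t) * s)
        * ((1 - (0 + (1/t) * s)) powr (a - 1) * (0 + (1/t) * s) powr (b - 1))))
       = (\<lambda>s. indicator {0..t} s *\<^sub>R ((t - s) powr (a - 1) * s powr (b - 1)))"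
    proof
      fix s :: real
      show "t powr (a + b - 2) * (indicator {0..1} (0 + (1/t) * s)
        * ((1 - (0 + (1/t) * s)) powr (a - 1) * (0 + (1/t) * s) powr (b - 1)))
        = indicator {0..t} s *\<^sub>R ((t - s) powr (a - 1) * s powr (b - 1))"
      proof (cases "s \<in> {0..t}")
        case True
        have "1 - s/t = (t - s) / t" using t by (simp add: field_simps)
        moreover have "t powr (a + b - 2) = t powr (a - 1) * t powr (b - 1)"
          by (simp flip: powr_add)
        ultimately show ?thesis using True t by (simp add: powr_divide)
      qed (use t in \<open>auto simp: indicator_def zero_le_divide_iff divide_le_eq\<close>)
    qed
    finally show ?thesis by (simp add: frac_integrable_def set_integrable_def)
  qed
qed

text \<open>
  A multiple of the kernel is a majorant; the Beta integral with exponent \<open>b = 1\<close> makes it integrable.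
\<close>

lemma frac_integrable_continuous:
  assumes "a > 0" "t \<ge> 0" "continuous_on {0..t} x"
  shows "frac_integrable a x t"
proof -
  obtain C where C: "\<And>s. s \<in> {0..t} \<Longrightarrow> norm (x s) \<le> C"
    using compact_imp_bounded[OF compact_continuous_image[OF assms(3)]]
    by (auto simp: bounded_iff simp del: atLeastAtMost_iff)
  have meas: "(\<lambda>s. indicator {0..t} s *\<^sub>R x s) \<in> borel_measurable borel"
    by (intro borel_measurable_continuous_on_indicator) (use assms in auto)
  have "set_integrable lborel {0..t} (\<lambda>s. C * ((t - s) powr (a - 1) * s powr (1 - 1)))"
    using frac_integrable_powr[OF assms(1) zero_less_one assms(2)]
    unfolding frac_integrable_def by (intro set_integrable_mult_right) simp
  then show ?thesis unfolding frac_integrable_def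
  proof (rule set_integrable_bound)
    have "(\<lambda>s. (t - s) powr (a - 1) * (indicator {0..t} s *\<^sub>R x s)) \<in> borel_measurable borel"
      using meas by measurable
    then show "set_borel_measurable lborel {0..t} (\<lambda>s. (t - s) powr (a - 1) * x s)"
      unfolding set_borel_measurable_def by (simp add: mult.left_commute)
    have "AE s in lborel. s \<noteq> (0::real)"
      by (rule AE_lborel_singleton)
    then show "AE s in lborel. s \<in> {0..t} \<longrightarrow> norm ((t - s) powr (a - 1) * x s)
        \<le> norm (C * ((t - s) powr (a - 1) * s powr (1 - 1)))"
    proof eventually_elim
      case (elim s)
      then show ?case using C[of s] by (auto simp: abs_mult mult.commute intro!: mult_right_mono)
    qed
  qed
qed

lemma frac_integral_add:
  assumes "a > 0" "frac_integrable a x t" "frac_integrable a y t"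
  shows "frac_integral a (\<lambda>s. x s + y s) t = frac_integral a x t + frac_integral a y t"
  using assms set_integral_add(2)[of lborel "{0..t}"
      "\<lambda>s. (t - s) powr (a - 1) * x s" "\<lambda>s. (t - s) powr (a - 1) * y s"]
  by (simp add: frac_integral_def frac_integrable_def distrib_left add_divide_distrib)

lemma frac_integral_cmult: "frac_integral a (\<lambda>s. c * x s) t = c * frac_integral a x t"
  using set_integral_mult_right[of lborel "{0..t}" c "\<lambda>s. (t - s) powr (a - 1) * x s"]
  by (simp add: frac_integral_def mult.left_commute)

lemma frac_integral_mono:
  assumes "a > 0" "frac_integrable a x t" "frac_integrable a y t"
    "\<And>s. 0 < s \<Longrightarrow> s < t \<Longrightarrow> x s \<le> y s"
  shows "frac_integral a x t \<le> frac_integral a y t"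
proof -
  have "AE s in lborel. s \<noteq> (0::real)" "AE s in lborel. s \<noteq> t"
    by (rule AE_lborel_singleton)+
  then have "AE s\<in>{0..t} in lborel. (t - s) powr (a - 1) * x s \<le> (t - s) powr (a - 1) * y s"
  proof eventually_elim
    case (elim s)
    then show ?case using assms(4)[of s] by (auto intro: mult_left_mono)
  qed
  from set_integral_mono_AE[OF _ _ this] show ?thesis
    using assms by (simp add: frac_integral_def frac_integrable_def divide_right_mono)
qed

text \<open>
  Admitting order \<open>0\<close>, the identity, lets \<open>I\<^sup>1\<^sup>-\<^sup>a\<close> be used below for \<open>a < 1\<close> and \<open>a = 1\<close> alike.
\<close>

lemma frac_integral_diff_continuous:
  assumes "a \<ge> 0" "t \<ge> 0" "continuous_on {0..t} x" "continuous_on {0..t} y"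
  shows "frac_integral a (\<lambda>s. x s - y s) t = frac_integral a x t - frac_integral a y t"
proof (cases "a = 0")
  case False
  then have a: "a > 0" using assms by simp
  have "frac_integrable a (\<lambda>s. (-1) * y s) t"
    by (intro frac_integrable_continuous continuous_intros assms a)
  from frac_integral_add[OF a frac_integrable_continuous[OF a assms(2,3)] this]
  show ?thesis using frac_integral_cmult[of a "-1" y t] by simp
qed simp

lemma frac_integral_const:
  assumes "a > 0" "t \<ge> 0"
  shows "frac_integral a (\<lambda>s. c) t = c * t powr a / Gamma (a + 1)"
proof -
  have "frac_integral a (\<lambda>s. 1) t = frac_integral a (\<lambda>s. s powr (1 - 1)) t"
  proof -
    have "AE s in lborel. s \<noteq> (0::real)"
      by (rule AE_lborel_singleton)
    then have "AE s in lborel. indicator {0..t} s *\<^sub>R ((t - s) powr (a - 1) * 1) =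
       indicator {0..t} s *\<^sub>R ((t - s) powr (a - 1) * s powr (1 - 1))"
      by eventually_elim auto
    then have "(LINT s:{0..t}|lborel. (t - s) powr (a - 1) * 1)
        = (LINT s:{0..t}|lborel. (t - s) powr (a - 1) * s powr (1 - 1))"
      unfolding set_lebesgue_integral_def by (intro integral_cong_AE) auto
    then show ?thesis unfolding frac_integral_def using assms(1) by auto
  qed
  also have "\<dots> = t powr a / Gamma (a + 1)"
    using frac_integral_powr[OF assms(1) zero_less_one assms(2)] by simp
  finally show ?thesis using frac_integral_cmult[of a c "\<lambda>s. 1" t] by simp
qed

lemma frac_integral_abs_le:
  assumes "a > 0" "t \<ge> 0" "continuous_on {0..t} x" "\<And>s. 0 \<le> s \<Longrightarrow> s \<le> t \<Longrightarrow> \<bar>x s\<bar> \<le> C"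
  shows "\<bar>frac_integral a x t\<bar> \<le> C * t powr a / Gamma (a + 1)"
proof -
  have i: "frac_integrable a x t" "frac_integrable a (\<lambda>s. C) t" "frac_integrable a (\<lambda>s. - C) t"
    by (intro frac_integrable_continuous continuous_intros assms)+
  have "frac_integral a x t \<le> C * t powr a / Gamma (a + 1)"
    using frac_integral_mono[OF assms(1) i(1,2)] assms(4) frac_integral_const[OF assms(1,2), of C]
    by (metis abs_le_D1 less_imp_le)
  moreover have "frac_integral a x t \<ge> - C * t powr a / Gamma (a + 1)"
    using frac_integral_mono[OF assms(1) i(3,1)] assms(4) frac_integral_const[OF assms(1,2), of "- C"]
    by (metis abs_le_iff less_imp_le minus_le_iff)
  ultimately show ?thesis by simp
qed

lemma continuous_on_frac_integral:
  assumes "a \<ge> 0" "continuous_on {0..b} x"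
  shows "continuous_on {0..b} (frac_integral a x)"
proof (cases "a = 0")
  case True
  then have "frac_integral a x = x" by auto
  then show ?thesis using assms by simp
next
  case False
  then have a: "a > 0" using assms by simp
  obtain C where C: "\<And>s. s \<in> {0..b} \<Longrightarrow> norm (x s) \<le> C"
    using compact_imp_bounded[OF compact_continuous_image[OF assms(2)]]
    by (auto simp: bounded_iff simp del: atLeastAtMost_iff)
  let ?k = "\<lambda>t s. indicator {0..1} s *\<^sub>R ((1 - s) powr (a - 1) * x (t * s))"
  have mem: "t * s \<in> {0..b}" if "t \<in> {0..b}" "s \<in> {0..1}" for t s :: real
    using that mult_mono[of t b s 1] by auto
  have meas: "?k t \<in> borel_measurable lborel" if "t \<in> {0..b}" for t
  proof -
    have "continuous_on {0..1} (\<lambda>s. x (t * s))"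
      by (rule continuous_on_compose2[OF assms(2)]) (use mem[OF that] in \<open>auto intro!: continuous_intros\<close>)
    then have "(\<lambda>s. indicator {0..1} s *\<^sub>R x (t * s)) \<in> borel_measurable borel"
      by (intro borel_measurable_continuous_on_indicator) auto
    then have "(\<lambda>s. (1 - s) powr (a - 1) * (indicator {0..1} s *\<^sub>R x (t * s))) \<in> borel_measurable borel"
      by measurable
    then show ?thesis by (simp add: mult.left_commute)
  qed
  have one: "frac_integrable a (\<lambda>s. C) 1"
    by (intro frac_integrable_continuous continuous_intros) (use a in auto)
  have "continuous_on {0..b} (\<lambda>t. LINT s:{0..1}|lborel. (1 - s) powr (a - 1) * x (t * s))"
    unfolding continuous_on_sequentially set_lebesgue_integral_def
  proof (intro allI ballI impI, elim conjE, unfold o_def)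
    fix u :: "nat \<Rightarrow> real" and t assume t: "t \<in> {0..b}" and u: "\<forall>n. u n \<in> {0..b}" "u \<longlonglongrightarrow> t"
    show "(\<lambda>n. \<integral>s. ?k (u n) s \<partial>lborel) \<longlonglongrightarrow> (\<integral>s. ?k t s \<partial>lborel)"
    proof (rule integral_dominated_convergence)
      show "integrable lborel (\<lambda>s. indicator {0..1} s *\<^sub>R ((1 - s) powr (a - 1) * C))"
        using one by (simp add: frac_integrable_def set_integrable_def)
      show "AE s in lborel. (\<lambda>n. ?k (u n) s) \<longlonglongrightarrow> ?k t s"
      proof (intro AE_I2)
        fix s :: real
        show "(\<lambda>n. ?k (u n) s) \<longlonglongrightarrow> ?k t s"
        proof (cases "s \<in> {0..1}")
          case True
          have "(\<lambda>n. x (u n * s)) \<longlonglongrightarrow> x (t * s)"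
            by (rule continuous_on_tendsto_compose[OF assms(2)])
               (use mem t u True in \<open>auto intro!: tendsto_intros always_eventually\<close>)
          then show ?thesis by (intro tendsto_intros)
        qed simp
      qed
      show "AE s in lborel. norm (?k (u n) s) \<le> indicator {0..1} s *\<^sub>R ((1 - s) powr (a - 1) * C)" for n
        using C mem u(1) by (intro AE_I2) (auto simp: indicator_def abs_mult intro!: mult_left_mono)
    qed (use meas t u in auto)
  qed
  then have "continuous_on {0..b} (\<lambda>t. t powr a / Gamma a
      * (LINT s:{0..1}|lborel. (1 - s) powr (a - 1) * x (t * s)))"
    by (intro continuous_intros continuous_on_powr') (use a in \<open>auto simp: Gamma_eq_zero_iff\<close>)
  then show ?thesis
    by (rule continuous_on_eq) (use frac_integral_scaled[OF a] in auto)
qed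

lemma frac_integral_mono_on:
  assumes "a \<ge> 0" "continuous_on {0..b} x" "mono_on {0..b} x" "x 0 \<ge> 0"
  shows "mono_on {0..b} (frac_integral a x)"
proof (cases "a = 0")
  case True
  then have "frac_integral a x = x" by auto
  then show ?thesis using assms by simp
next
  case False
  then have a: "a > 0" using assms by simp
  show ?thesis
  proof (rule mono_onI)
    fix t u assume tu: "t \<in> {0..b}" "u \<in> {0..b}" "t \<le> u"
    have int: "frac_integrable a (\<lambda>s. x (w * s)) 1" if "w \<in> {0..b}" for w
      by (intro frac_integrable_continuous continuous_on_compose2[OF assms(2)] continuous_intros a)
         (use that mult_mono[of w b _ 1] in auto)
    have le: "x (t * s) \<le> x (u * s)" "0 \<le> x (t * s)" if "0 \<le> s" "s \<le> 1" for s
    proof -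
      have *: "t * s \<le> u * s" "0 \<le> t * s" "u * s \<le> b"
        using tu that mult_mono[of u b s 1] by (auto intro: mult_right_mono)
      then show "x (t * s) \<le> x (u * s)" by (intro mono_onD[OF assms(3)]) auto
      have "x 0 \<le> x (t * s)" using * by (intro mono_onD[OF assms(3)]) auto
      then show "0 \<le> x (t * s)" using assms(4) by simp
    qed
    have "frac_integral a (\<lambda>s. x (t * s)) 1 \<le> frac_integral a (\<lambda>s. x (u * s)) 1"
      by (rule frac_integral_mono) (use a int tu le in auto)
    moreover have "0 \<le> frac_integral a (\<lambda>s. x (t * s)) 1"
      using frac_integral_mono[OF a _ int[OF tu(1)], of "\<lambda>s. 0"] le a
        frac_integrable_continuous[OF a zero_le_one, of "\<lambda>s. 0"] frac_integral_const[OF a zero_le_one, of 0]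
      by simp
    moreover have "frac_integral a x w = t' * frac_integral a (\<lambda>s. x (w * s)) 1"
      if "w \<in> {0..b}" "t' = w powr a" for w t'
      using frac_integral_scaled[OF a, of w x] frac_integral_scaled[OF a zero_le_one, of "\<lambda>s. x (w * s)"] that
      by simp
    ultimately show "frac_integral a x t \<le> frac_integral a x u"
      using tu a by (auto intro!: mult_mono powr_mono2)
  qed
qed

lemma frac_integral_sum:
  assumes "a > 0" "\<And>i. i \<in> A \<Longrightarrow> frac_integrable a (x i) t"
  shows "frac_integral a (\<lambda>s. \<Sum>i\<in>A. x i s) t = (\<Sum>i\<in>A. frac_integral a (x i) t)"
    and "frac_integrable a (\<lambda>s. \<Sum>i\<in>A. x i s) t"
proof -
  have "frac_integral a (\<lambda>s. \<Sum>i\<in>A. x i s) t = (\<Sum>i\<in>A. frac_integral a (x i) t) \<and>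
     frac_integrable a (\<lambda>s. \<Sum>i\<in>A. x i s) t" using assms(2)
  proof (induction A rule: infinite_finite_induct)
    case (insert j A)
    then have 1: "frac_integrable a (x j) t" "frac_integrable a (\<lambda>s. \<Sum>i\<in>A. x i s) t" by auto
    then have "frac_integrable a (\<lambda>s. x j s + (\<Sum>i\<in>A. x i s)) t"
      by (simp add: frac_integrable_def distrib_left)
    then show ?case using insert frac_integral_add[OF assms(1) 1] by simp
  qed (use assms(1) in \<open>auto simp: frac_integral_def frac_integrable_def set_integrable_def set_lebesgue_integral_def\<close>)
  then show "frac_integral a (\<lambda>s. \<Sum>i\<in>A. x i s) t = (\<Sum>i\<in>A. frac_integral a (x i) t)"
    "frac_integrable a (\<lambda>s. \<Sum>i\<in>A. x i s) t" by auto
qed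

lemma frac_integral_power:
  assumes "a > 0" "t \<ge> 0"
  shows "frac_integral a (\<lambda>s. s ^ n) t = fact n / Gamma (a + n + 1) * t powr (a + n)"
proof (cases n)
  case 0
  then show ?thesis using frac_integral_const[OF assms, of 1] by simp
next
  case (Suc k)
  have "frac_integral a (\<lambda>s. s ^ n) t = frac_integral a (\<lambda>s. s powr (real n + 1 - 1)) t"
    by (rule frac_integral_cong) (use assms Suc powr_realpow'[of _ n] in auto)
  also have "\<dots> = Gamma (real n + 1) / Gamma (a + (real n + 1)) * t powr (a + (real n + 1) - 1)"
    using frac_integral_powr[OF assms(1) _ assms(2), of "real n + 1"] by (simp add: add.commute)
  also have "Gamma (real n + 1) = fact n"
    using Gamma_fact[of n, where ?'a = real] by (metis add.commute)
  finally show ?thesis by (simp add: add.assoc)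
qed

text \<open>
  The Riemann--Liouville semigroup law. It holds for monomials by Euler's Beta integral, both sides
  are linear and bounded in the supremum norm, and polynomials are dense.
\<close>

lemma frac_integral_semigroup:
  assumes "a \<ge> 0" "b \<ge> 0" "t \<ge> 0" "continuous_on {0..t} x"
  shows "frac_integral a (frac_integral b x) t = frac_integral (a + b) x t"
proof (cases "a = 0 \<or> b = 0")
  case True
  moreover have "frac_integral 0 x = x" by auto
  ultimately show ?thesis by auto
next
  case False
  then have a: "a > 0" and b: "b > 0" using assms by auto
  then have ab: "a + b > 0" by simp
  have poly: "frac_integral a (frac_integral b g) t = frac_integral (a + b) g t"
    if g: "real_polynomial_function g" for g
  proof -
    obtain c n where g: "g = (\<lambda>s. \<Sum>i\<le>n. c i * s ^ i)"
      using g unfolding real_polynomial_function_iff_sum by auto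
    have intp: "frac_integrable a' (\<lambda>s. c i * s ^ i) s" if "a' > 0" "s \<ge> 0" for a' s and i::nat
      using that by (intro frac_integrable_continuous continuous_intros) auto
    have b1: "frac_integral b g s = (\<Sum>i\<le>n. c i * (fact i / Gamma (b + i + 1)) * s powr (b + i + 1 - 1))"
      if "s \<ge> 0" for s
      unfolding g using that b
      by (subst frac_integral_sum(1)) (auto simp: intp frac_integral_cmult frac_integral_power mult.assoc)
    have int2: "frac_integrable a (\<lambda>s. c i * (fact i / Gamma (b + i + 1)) * s powr (b + i + 1 - 1)) t"
      for i :: nat
      using frac_integrable_powr[OF a _ assms(3), of "b + i + 1"] b
      unfolding frac_integrable_def by (subst mult.left_commute, intro set_integrable_mult_right) simp
    have "frac_integral a (frac_integral b g) t
        = frac_integral a (\<lambda>s. \<Sum>i\<le>n. c i * (fact i / Gamma (b + i + 1)) * s powr (b + i + 1 - 1)) t"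
      by (rule frac_integral_cong) (use assms b1 in auto)
    also have "\<dots> = (\<Sum>i\<le>n. c i * (fact i / Gamma (b + i + 1)) *
        (Gamma (b + i + 1) / Gamma (a + (b + i + 1)) * t powr (a + (b + i + 1) - 1)))"
    proof (subst frac_integral_sum(1)[OF a int2], rule sum.cong)
      fix i assume "i \<in> {..n}"
      have "b + real i + 1 > 0" using b by simp
      from frac_integral_powr[OF a this assms(3)]
      show "frac_integral a (\<lambda>s. c i * (fact i / Gamma (b + i + 1)) * s powr (b + i + 1 - 1)) t
        = c i * (fact i / Gamma (b + i + 1)) *
          (Gamma (b + i + 1) / Gamma (a + (b + i + 1)) * t powr (a + (b + i + 1) - 1))"
        by (simp only: frac_integral_cmult)
    qed simp
    also have "\<dots> = (\<Sum>i\<le>n. c i * (fact i / Gamma (a + b + i + 1) * t powr (a + b + i)))"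
    proof (rule sum.cong)
      fix i assume "i \<in> {..n}"
      have "Gamma (b + real i + 1) > 0" using b by (intro Gamma_real_pos) simp
      then show "c i * (fact i / Gamma (b + i + 1)) *
        (Gamma (b + i + 1) / Gamma (a + (b + i + 1)) * t powr (a + (b + i + 1) - 1))
        = c i * (fact i / Gamma (a + b + i + 1) * t powr (a + b + i))"
        by (simp add: add_ac)
    qed simp
    also have "\<dots> = frac_integral (a + b) g t"
      unfolding g using assms(3) ab
      by (subst frac_integral_sum(1)) (auto simp: intp frac_integral_cmult frac_integral_power)
    finally show ?thesis .
  qed
  let ?K = "t powr b / Gamma (b + 1) * t powr a / Gamma (a + 1) + t powr (a + b) / Gamma (a + b + 1)"
  have "\<bar>frac_integral a (frac_integral b x) t - frac_integral (a + b) x t\<bar> \<le> e * ?K" if e: "e > 0" for e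
  proof -
    obtain g where g: "real_polynomial_function g" "\<And>s. s \<in> {0..t} \<Longrightarrow> \<bar>x s - g s\<bar> < e"
      using Stone_Weierstrass_real_polynomial_function[OF compact_Icc assms(4) e] by blast
    have cg: "continuous_on S g" for S
      using g(1) unfolding real_polynomial_function_iff_sum by (auto intro!: continuous_intros)
    let ?d = "\<lambda>s. x s - g s"
    have cd: "continuous_on {0..s} ?d" if "s \<le> t" for s
      using assms(4) that cg by (intro continuous_intros) (auto intro: continuous_on_subset)
    have 1: "frac_integral b ?d s = frac_integral b x s - frac_integral b g s"
      if "0 \<le> s" "s \<le> t" for s
      using that assms b cg
      by (intro frac_integral_diff_continuous) (auto intro: continuous_on_subset)
    have bnd: "\<bar>frac_integral b ?d s\<bar> \<le> e * t powr b / Gamma (b + 1)" if s: "0 \<le> s" "s \<le> t" for s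
    proof -
      have "\<bar>frac_integral b ?d s\<bar> \<le> e * s powr b / Gamma (b + 1)"
        by (rule frac_integral_abs_le) (use b s cd g(2) in \<open>auto simp: less_imp_le\<close>)
      also have "\<dots> \<le> e * t powr b / Gamma (b + 1)"
        using b s \<open>e > 0\<close> by (intro divide_right_mono mult_left_mono powr_mono2) (auto simp: less_imp_le)
      finally show ?thesis .
    qed
    have 2: "frac_integral a (frac_integral b ?d) t
        = frac_integral a (frac_integral b x) t - frac_integral a (frac_integral b g) t"
    proof -
      have "frac_integral a (frac_integral b ?d) t
          = frac_integral a (\<lambda>s. frac_integral b x s - frac_integral b g s) t"
        by (rule frac_integral_cong) (use assms 1 in auto)
      also have "\<dots> = frac_integral a (frac_integral b x) t - frac_integral a (frac_integral b g) t"
        by (intro frac_integral_diff_continuous continuous_on_frac_integral cg assms)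
      finally show ?thesis .
    qed
    have 3: "frac_integral (a + b) ?d t = frac_integral (a + b) x t - frac_integral (a + b) g t"
      by (intro frac_integral_diff_continuous cg assms) (use ab in simp)
    have 4: "\<bar>frac_integral a (frac_integral b ?d) t\<bar> \<le> (e * t powr b / Gamma (b + 1)) * t powr a / Gamma (a + 1)"
      by (rule frac_integral_abs_le) (use a assms bnd cd b in \<open>auto intro!: continuous_on_frac_integral\<close>)
    have 5: "\<bar>frac_integral (a + b) ?d t\<bar> \<le> e * t powr (a + b) / Gamma (a + b + 1)"
      by (rule frac_integral_abs_le) (use ab assms cd g(2) in \<open>auto simp: less_imp_le\<close>)
    have "\<bar>frac_integral a (frac_integral b x) t - frac_integral (a + b) x t\<bar>
        = \<bar>frac_integral a (frac_integral b ?d) t - frac_integral (a + b) ?d t\<bar>"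
      using 2 3 poly[OF g(1)] by simp
    also have "\<dots> \<le> e * ?K" using 4 5 by (simp add: algebra_simps)
    finally show ?thesis .
  qed
  note lim = this
  have "((\<lambda>e. e * ?K) \<longlongrightarrow> 0 * ?K) (at_right 0)" by (intro tendsto_intros)
  moreover have "eventually (\<lambda>e. \<bar>frac_integral a (frac_integral b x) t - frac_integral (a + b) x t\<bar> \<le> e * ?K) (at_right 0)"
    using lim by (auto simp: eventually_at_right_less intro: eventually_mono[OF eventually_at_right_less])
  ultimately have "\<bar>frac_integral a (frac_integral b x) t - frac_integral (a + b) x t\<bar> \<le> 0 * ?K"
    by (intro tendsto_lowerbound) auto
  then show ?thesis by simp
qed

section \<open>Caputo equations and scalar comparison\<close>

lemma frac_integral_1:
  assumes "t \<ge> 0" "continuous_on {0..t} x"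
  shows "frac_integral 1 x t = integral {0..t} x"
proof -
  have int: "set_integrable lborel {0..t} x"
    by (rule borel_integrable_atLeastAtMost'[OF assms(2)])
  have int1: "frac_integrable 1 x t"
    by (rule frac_integrable_continuous) (use assms in auto)
  have "AE s in lborel. s \<noteq> t" by (rule AE_lborel_singleton)
  then have "AE s in lborel. indicator {0..t} s *\<^sub>R ((t - s) powr (1 - 1) * x s) = indicator {0..t} s *\<^sub>R x s"
    by eventually_elim auto
  then have "(LINT s:{0..t}|lborel. (t - s) powr (1 - 1) * x s) = (LINT s:{0..t}|lborel. x s)"
    unfolding set_lebesgue_integral_def
    using int int1 unfolding set_integrable_def frac_integrable_def
    by (intro integral_cong_AE borel_measurable_integrable)
  then show ?thesis
    using set_borel_integral_eq_integral(2)[OF int] by (simp add: frac_integral_def)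
qed

lemma frac_integral_1_deriv:
  assumes "continuous_on {0..b} x" "0 < t" "t < b"
  shows "(frac_integral 1 x has_real_derivative x t) (at t)"
proof -
  have "((\<lambda>u. integral {0..u} x) has_real_derivative x t) (at t within {0..b})"
    by (rule integral_has_real_derivative[OF assms(1)]) (use assms in auto)
  then have "((\<lambda>u. integral {0..u} x) has_real_derivative x t) (at t)"
    using assms by (simp add: at_within_Icc_at)
  then show ?thesis
  proof (rule DERIV_cong_ev[OF refl _ refl, THEN iffD1, rotated])
    have "eventually (\<lambda>u. u \<in> {0<..<b}) (nhds t)"
      by (rule eventually_nhds_in_open) (use assms in auto)
    then show "\<forall>\<^sub>F u in nhds t. integral {0..u} x = frac_integral 1 x u"
    proof eventually_elim
      case (elim u)
      then show ?case
        by (intro frac_integral_1[symmetric] continuous_on_subset[OF assms(1)]) auto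
    qed
  qed
qed

lemma volterra_imp_caputo:
  assumes a: "0 < a" "a \<le> 1" and h: "continuous_on {0..b} h"
    and x: "\<And>t. 0 \<le> t \<Longrightarrow> t \<le> b \<Longrightarrow> x t = x 0 + frac_integral a h t"
    and t: "0 < t" "t < b"
  shows "has_caputo_derivative a x (h t) t"
  unfolding has_caputo_derivative_def
proof (rule DERIV_cong_ev[OF refl _ refl, THEN iffD1, rotated])
  show "(frac_integral 1 h has_real_derivative h t) (at t)"
    by (rule frac_integral_1_deriv[OF h t])
  have "eventually (\<lambda>u. u \<in> {0<..<b}) (nhds t)"
    by (rule eventually_nhds_in_open) (use t in auto)
  then show "\<forall>\<^sub>F u in nhds t. frac_integral 1 h u = frac_integral (1 - a) (\<lambda>s. x s - x 0) u"
  proof eventually_elim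
    case (elim u)
    have "frac_integral (1 - a) (\<lambda>s. x s - x 0) u = frac_integral (1 - a) (frac_integral a h) u"
    proof (rule frac_integral_cong)
      fix s assume "0 \<le> s" "s \<le> u"
      then show "x s - x 0 = frac_integral a h s" using x[of s] elim by simp
    qed (use elim in auto)
    also have "\<dots> = frac_integral (1 - a + a) h u"
      by (rule frac_integral_semigroup) (use a elim in \<open>auto intro: continuous_on_subset[OF h]\<close>)
    finally show ?case by simp
  qed
qed

text \<open>
  Both sides of the Caputo equation are integrated: \<open>I\<^sup>1\<^sup>-\<^sup>a (x - x 0) = I\<^sup>1 h\<close>. Applying
  \<open>I\<^sup>a\<close> gives \<open>I\<^sup>1 (x - x 0) = I\<^sup>1 (I\<^sup>a h)\<close>, and \<open>I\<^sup>1\<close> is undone by an ordinary derivative.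
\<close>

lemma caputo_imp_volterra:
  assumes a: "0 < a" "a \<le> 1" and x: "continuous_on {0..b} x" and h: "continuous_on {0..b} h"
    and D: "\<And>t. 0 < t \<Longrightarrow> t < b \<Longrightarrow> has_caputo_derivative a x (h t) t"
    and t: "0 \<le> t" "t < b"
  shows "x t = x 0 + frac_integral a h t"
proof (cases "t = 0")
  case False
  define X where "X = (\<lambda>s. x s - x 0)"
  have b: "0 < b" using t by simp
  have X: "continuous_on {0..s} X" if "s \<le> b" for s
    using x that unfolding X_def by (intro continuous_intros) (auto intro: continuous_on_subset)
  have hs: "continuous_on {0..s} h" if "s \<le> b" for s
    using h that by (auto intro: continuous_on_subset)
  have GH: "frac_integral (1 - a) X s = frac_integral 1 h s" if s: "0 \<le> s" "s \<le> b" for s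
  proof -
    let ?d = "\<lambda>s. frac_integral (1 - a) X s - frac_integral 1 h s"
    have "?d s = ?d 0"
    proof (rule DERIV_isconst2[OF b])
      show "continuous_on {0..b} ?d"
        by (intro continuous_intros continuous_on_frac_integral X h) (use a in auto)
      show "DERIV ?d u :> 0" if "0 < u" "u < b" for u
        using DERIV_diff[OF D[OF that, unfolded has_caputo_derivative_def] frac_integral_1_deriv[OF h that]]
        by (simp add: X_def)
    qed (use s in auto)
    also have "?d 0 = 0"
      using a by (cases "a = 1") (auto simp: X_def)
    finally show ?thesis by simp
  qed
  have eq: "frac_integral 1 X s = frac_integral 1 (frac_integral a h) s" if s: "0 \<le> s" "s \<le> b" for s
  proof -
    have "frac_integral 1 X s = frac_integral a (frac_integral (1 - a) X) s"
      using frac_integral_semigroup[of a "1 - a" s X] a s X by simp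
    also have "\<dots> = frac_integral a (frac_integral 1 h) s"
      by (rule frac_integral_cong) (use s GH in auto)
    also have "\<dots> = frac_integral 1 (frac_integral a h) s"
      using frac_integral_semigroup[of a 1 s h] frac_integral_semigroup[of 1 a s h] a s hs
      by (simp add: add.commute)
    finally show ?thesis .
  qed
  have "(frac_integral 1 X has_real_derivative X t) (at t)"
    by (rule frac_integral_1_deriv[of b]) (use X t False in auto)
  moreover have "(frac_integral 1 X has_real_derivative frac_integral a h t) (at t)"
  proof (rule DERIV_cong_ev[OF refl _ refl, THEN iffD1, rotated])
    show "(frac_integral 1 (frac_integral a h) has_real_derivative frac_integral a h t) (at t)"
      by (rule frac_integral_1_deriv[of b]) (use a t False h in \<open>auto intro!: continuous_on_frac_integral\<close>)
    have "eventually (\<lambda>u. u \<in> {0<..<b}) (nhds t)"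
      by (rule eventually_nhds_in_open) (use t False in auto)
    then show "\<forall>\<^sub>F u in nhds t. frac_integral 1 (frac_integral a h) u = frac_integral 1 X u"
      by eventually_elim (use eq in auto)
  qed
  ultimately show ?thesis by (auto dest: DERIV_unique simp: X_def)
qed (use a in simp)

lemma frac_integral_split:
  assumes a: "a > 0" and c: "0 \<le> c" "0 \<le> t" and x: "continuous_on {0..c + t} x"
  shows "frac_integral a x (c + t) =
      1 / Gamma a * (LINT s:{0..c}|lborel. (c + t - s) powr (a - 1) * x s)
      + frac_integral a (\<lambda>s. x (c + s)) t"
    and "set_integrable lborel {0..c} (\<lambda>s. (c + t - s) powr (a - 1) * x s)"
proof -
  let ?k = "\<lambda>s. (c + t - s) powr (a - 1) * x s"
  have int: "set_integrable lborel {0..c + t} ?k"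
    using frac_integrable_continuous[OF a _ x] c by (simp add: frac_integrable_def)
  have int1: "set_integrable lborel {0..c} ?k" and int2: "set_integrable lborel {c..c + t} ?k"
    by (rule set_integrable_subset[OF int]; use c in auto)+
  show "set_integrable lborel {0..c} ?k" by (rule int1)
  have "(LINT s:{0..c + t}|lborel. ?k s) = (LINT s:{0..c}|lborel. ?k s) + (LINT s:{c..c + t}|lborel. ?k s)"
    using set_borel_integral_eq_integral[OF int] set_borel_integral_eq_integral(2)[OF int1]
      set_borel_integral_eq_integral(2)[OF int2]
      Henstock_Kurzweil_Integration.integral_combine[of 0 c "c + t" ?k] c by simp
  moreover have "(LINT s:{c..c + t}|lborel. ?k s) = (LINT s:{0..t}|lborel. (t - s) powr (a - 1) * x (c + s))"
    unfolding set_lebesgue_integral_def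
    by (subst lborel_integral_real_affine[where c = 1 and t = c])
       (auto intro!: Bochner_Integration.integral_cong simp: indicator_def)
  ultimately show "frac_integral a x (c + t) = 1 / Gamma a * (LINT s:{0..c}|lborel. ?k s)
      + frac_integral a (\<lambda>s. x (c + s)) t"
    using a by (simp add: frac_integral_def add_divide_distrib)
qed

text \<open>
  A fractional equation does not restart at a later time \<open>c\<close>, because the kernel remembers
  \<open>{0..c}\<close>. If \<open>y\<close> has been nonnegative so far, however, the memory can only push \<open>y\<close> up: the
  contribution of the past to \<open>I\<^sup>1\<^sup>-\<^sup>a y\<close> decreases as it recedes, so
  \<open>R = I\<^sup>1\<^sup>-\<^sup>a y(c + \<cdot>) - I\<^sup>1 D(c + \<cdot>)\<close> increases, hence so does
  \<open>I\<^sup>a R = I\<^sup>1 (y(c + \<cdot>) - I\<^sup>a D(c + \<cdot>))\<close>, whose derivative is therefore nonnegative.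
\<close>

lemma frac_restart:
  assumes a: "0 < a" "a \<le> 1" and D: "continuous_on {0..b} D"
    and y: "\<And>t. 0 \<le> t \<Longrightarrow> t \<le> b \<Longrightarrow> y t = y0 + frac_integral a D t" and y0: "y0 \<ge> 0"
    and c: "0 \<le> c" and pos: "\<And>t. 0 \<le> t \<Longrightarrow> t \<le> c \<Longrightarrow> y t \<ge> 0"
    and t: "0 \<le> t" "c + t < b"
  shows "frac_integral a (\<lambda>s. D (c + s)) t \<le> y (c + t)"
proof (cases "t = 0")
  case True
  then show ?thesis using a c pos[of c] by simp
next
  case False
  define e where "e = b - c"
  have e: "0 < t" "t < e" using t False by (auto simp: e_def)
  define Y E where "Y = (\<lambda>s. y (c + s))" and "E = (\<lambda>s. D (c + s))"
  have cy: "continuous_on {0..b} y"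
  proof (rule continuous_on_eq)
    show "continuous_on {0..b} (\<lambda>t. y0 + frac_integral a D t)"
      by (intro continuous_intros continuous_on_frac_integral D) (use a in auto)
  qed (use y in auto)
  have cY: "continuous_on {0..u} Y" and cE: "continuous_on {0..u} E" if "u \<le> e" for u
    unfolding Y_def E_def using that c
    by (auto intro!: continuous_on_compose2[OF cy] continuous_on_compose2[OF D] continuous_intros simp: e_def)
  have cD: "continuous_on {0..u} D" if "u \<le> b" for u
    using that by (auto intro: continuous_on_subset[OF D])
  define R where "R = (\<lambda>u. frac_integral (1 - a) Y u - frac_integral 1 E u)"
  have cR: "continuous_on {0..u} R" if "u \<le> e" for u
    unfolding R_def by (intro continuous_intros continuous_on_frac_integral cY cE that) (use a in auto)
  have E1: "frac_integral 1 E u = frac_integral 1 D (c + u) - frac_integral 1 D c" if u: "0 \<le> u" "u \<le> e" for u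
  proof -
    have "(LINT s:{0..c}|lborel. (c + u - s) powr (1 - 1) * D s) = (LINT s:{0..c}|lborel. (c - s) powr (1 - 1) * D s)"
    proof -
      have i: "set_integrable lborel {0..c} (\<lambda>s. (c + u - s) powr (1 - 1) * D s)"
        by (rule frac_integral_split(2)) (use c u cD in \<open>auto simp: e_def\<close>)
      have j: "frac_integrable 1 D c"
        by (rule frac_integrable_continuous) (use c u cD in \<open>auto simp: e_def\<close>)
      have "AE s in lborel. s \<noteq> c" by (rule AE_lborel_singleton)
      then have "AE s in lborel. indicator {0..c} s *\<^sub>R ((c + u - s) powr (1 - 1) * D s)
          = indicator {0..c} s *\<^sub>R ((c - s) powr (1 - 1) * D s)"
        by eventually_elim (use u in \<open>auto simp: indicator_def\<close>)
      then show ?thesis using i j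
        unfolding set_lebesgue_integral_def set_integrable_def frac_integrable_def
        by (intro integral_cong_AE borel_measurable_integrable)
    qed
    then show ?thesis
      using frac_integral_split(1)[of 1 c u D] c u cD by (simp add: frac_integral_def E_def e_def)
  qed
  have "mono_on {0..e} R"
  proof (cases "a = 1")
    case True
    have "R u = y c" if "u \<in> {0..e}" for u
      using E1[of u] that y[of "c + u"] y[of c] True c by (simp add: R_def Y_def e_def)
    then show ?thesis by (intro mono_onI) simp
  next
    case False
    then have a': "1 - a > 0" using a by simp
    define Q where "Q = (\<lambda>u. LINT s:{0..c}|lborel. (c + u - s) powr (1 - a - 1) * y s)"
    have Iy: "frac_integral (1 - a) y u = y0 * u powr (1 - a) / Gamma (1 - a + 1) + frac_integral 1 D u"
      if u: "0 \<le> u" "u \<le> b" for u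
    proof -
      have "frac_integral (1 - a) y u = frac_integral (1 - a) (\<lambda>s. y0 + frac_integral a D s) u"
        by (rule frac_integral_cong) (use u y in auto)
      also have "\<dots> = frac_integral (1 - a) (\<lambda>s. y0) u + frac_integral (1 - a) (frac_integral a D) u"
        by (intro frac_integral_add a' frac_integrable_continuous u continuous_on_frac_integral cD continuous_intros)
           (use a in auto)
      also have "frac_integral (1 - a) (frac_integral a D) u = frac_integral 1 D u"
        using frac_integral_semigroup[of "1 - a" a u D] a u cD by simp
      finally show ?thesis using frac_integral_const[OF a' u(1), of y0] by simp
    qed
    have R: "R u = y0 * (c + u) powr (1 - a) / Gamma (1 - a + 1) - 1 / Gamma (1 - a) * Q u
        + frac_integral 1 D c" if u: "u \<in> {0..e}" for u
    proof -
      have "frac_integral (1 - a) y (c + u) = 1 / Gamma (1 - a) * Q u + frac_integral (1 - a) Y u"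
        unfolding Q_def Y_def
        by (rule frac_integral_split) (use a' c u in \<open>auto simp: e_def intro!: continuous_on_subset[OF cy]\<close>)
      then show ?thesis
        using Iy[of "c + u"] E1[of u] u c by (simp add: R_def e_def)
    qed
    show ?thesis
    proof (rule mono_onI)
      fix u v assume uv: "u \<in> {0..e}" "v \<in> {0..e}" "u \<le> v"
      have "Q v \<le> Q u" unfolding Q_def
      proof (rule set_integral_mono_AE)
        show "set_integrable lborel {0..c} (\<lambda>s. (c + v - s) powr (1 - a - 1) * y s)"
          "set_integrable lborel {0..c} (\<lambda>s. (c + u - s) powr (1 - a - 1) * y s)"
          by (rule frac_integral_split(2);
              use a' c uv in \<open>auto simp: e_def intro!: continuous_on_subset[OF cy]\<close>)+
        have "AE s in lborel. s \<noteq> c" by (rule AE_lborel_singleton)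
        then show "AE s\<in>{0..c} in lborel. (c + v - s) powr (1 - a - 1) * y s \<le> (c + u - s) powr (1 - a - 1) * y s"
          by eventually_elim (use uv a pos in \<open>auto intro!: mult_right_mono powr_mono2'\<close>)
      qed
      moreover have "(c + u) powr (1 - a) \<le> (c + v) powr (1 - a)"
        using uv c a' by (intro powr_mono2) auto
      ultimately show "R u \<le> R v"
        unfolding R[OF uv(1)] R[OF uv(2)] using y0 a' Gamma_real_pos[of "1 - a + 1"] Gamma_real_pos[of "1 - a"]
        by (intro add_right_mono diff_mono divide_right_mono mult_left_mono) auto
    qed
  qed
  moreover have "R 0 \<ge> 0"
    using a c pos[of c] by (cases "a = 1") (auto simp: R_def Y_def)
  ultimately have "mono_on {0..e} (frac_integral a R)"
    by (intro frac_integral_mono_on cR) (use a in auto)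
  moreover have "frac_integral a R u = frac_integral 1 (\<lambda>s. Y s - frac_integral a E s) u" if u: "u \<in> {0..e}" for u
  proof -
    have "frac_integral a R u = frac_integral a (frac_integral (1 - a) Y) u - frac_integral a (frac_integral 1 E) u"
      unfolding R_def
      by (intro frac_integral_diff_continuous continuous_on_frac_integral cY cE) (use a u in auto)
    also have "\<dots> = frac_integral 1 Y u - frac_integral 1 (frac_integral a E) u"
      using frac_integral_semigroup[of a "1 - a" u Y] frac_integral_semigroup[of a 1 u E]
        frac_integral_semigroup[of 1 a u E] a u cY cE by (simp add: add.commute)
    also have "\<dots> = frac_integral 1 (\<lambda>s. Y s - frac_integral a E s) u"
      by (intro frac_integral_diff_continuous[symmetric] continuous_on_frac_integral cY cE) (use a u in auto)
    finally show ?thesis .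
  qed
  ultimately have "mono_on {0..e} (frac_integral 1 (\<lambda>s. Y s - frac_integral a E s))"
    by (simp add: mono_on_def)
  moreover have "(frac_integral 1 (\<lambda>s. Y s - frac_integral a E s) has_real_derivative (Y t - frac_integral a E t)) (at t)"
    by (rule frac_integral_1_deriv[of e])
       (use e a cY cE in \<open>auto intro!: continuous_intros continuous_on_frac_integral\<close>)
  ultimately have "Y t - frac_integral a E t \<ge> 0"
    using e by (intro mono_on_imp_deriv_nonneg) auto
  then show ?thesis by (simp add: Y_def E_def)
qed

lemma continuous_on_atLeast_if_Icc:
  fixes f :: "real \<Rightarrow> 'a :: topological_space"
  assumes "\<And>T. continuous_on {0..T} f"
  shows "continuous_on {0..} f"
  unfolding continuous_on_eq_continuous_within
proof
  fix x :: real assume x: "x \<in> {0..}"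
  have "at x within {0..} = at x within {0..x + 1}"
    by (rule at_within_nhd[of x "{..<x + 1}"]) auto
  then show "continuous (at x within {0..}) f"
    using assms[of "x + 1"] x by (simp add: continuous_on_eq_continuous_within)
qed

text \<open>
  At the first time \<open>c\<close> after which \<open>y\<close> takes negative values, \<open>y c = 0\<close>, so \<open>D\<close> is positive on
  some \<open>{c..<c + d}\<close>; restarting at \<open>c\<close> then keeps \<open>y\<close> nonnegative there.
\<close>

lemma frac_comparison:
  assumes a: "0 < a" "a \<le> 1" and D: "continuous_on {0..} D"
    and y: "\<And>t. 0 \<le> t \<Longrightarrow> y t = y0 + frac_integral a D t" and y0: "y0 \<ge> 0"
    and touch: "\<And>t. 0 \<le> t \<Longrightarrow> y t = 0 \<Longrightarrow> D t > 0"
    and t: "0 \<le> t"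
  shows "y t \<ge> 0"
proof (rule ccontr)
  assume "\<not> y t \<ge> 0"
  define S where "S = {s. 0 \<le> s \<and> y s < 0}"
  have S: "t \<in> S" "bdd_below S" "\<And>s. s \<in> S \<Longrightarrow> 0 \<le> s"
    using \<open>\<not> y t \<ge> 0\<close> t by (auto simp: S_def intro!: bdd_belowI[of _ 0])
  define c where "c = Inf S"
  have c: "0 \<le> c" unfolding c_def using S by (intro cInf_greatest) auto
  have before: "y s \<ge> 0" if "0 \<le> s" "s < c" for s
    using that cInf_lower[OF _ S(2), of s] by (force simp: S_def c_def)
  have cy: "continuous_on {0..u} y" for u
  proof (rule continuous_on_eq)
    show "continuous_on {0..u} (\<lambda>t. y0 + frac_integral a D t)"
      by (intro continuous_intros continuous_on_frac_integral continuous_on_subset[OF D]) (use a in auto)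
  qed (use y in auto)
  have "isCont (\<lambda>s. y (max 0 s)) c"
  proof -
    have "continuous_on UNIV (\<lambda>s. y (max 0 s))"
      by (rule continuous_on_compose2[OF continuous_on_atLeast_if_Icc[OF cy]])
         (auto intro!: continuous_intros)
    then show ?thesis by (simp add: continuous_on_eq_continuous_at)
  qed
  then have lim: "((\<lambda>s. y (max 0 s)) \<longlongrightarrow> y c) (at c)"
    using c by (simp add: isCont_def)
  have yc: "y c \<ge> 0"
  proof (cases "c = 0")
    case True
    then show ?thesis using y[of 0] y0 a by simp
  next
    case False
    have "((\<lambda>s. y (max 0 s)) \<longlongrightarrow> y c) (at_left c)"
      using lim by (rule tendsto_mono[rotated]) (simp add: at_le)
    moreover have "eventually (\<lambda>s. y (max 0 s) \<ge> 0) (at_left c)"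
    proof -
      have "0 < c" using False c by simp
      then show ?thesis
        unfolding eventually_at_left[OF \<open>0 < c\<close>] using before by (intro exI[of _ 0]) (auto simp: max_def)
    qed
    ultimately show ?thesis by (intro tendsto_lowerbound) auto
  qed
  have near: "\<exists>s\<in>S. s < c + d" if "d > 0" for d
    using cInf_lessD[of S "c + d"] S(1) that by (auto simp: c_def)
  have "y c = 0"
  proof (rule ccontr)
    assume "y c \<noteq> 0"
    with yc have "y c > 0" by simp
    then have "eventually (\<lambda>s. y (max 0 s) > 0) (at c)"
      by (rule order_tendstoD(1)[OF lim])
    then obtain d where d: "d > 0" "\<And>s. s \<noteq> c \<Longrightarrow> dist s c < d \<Longrightarrow> y (max 0 s) > 0"
      by (auto simp: eventually_at)
    obtain s where s: "s \<in> S" "s < c + d" using near[OF d(1)] by auto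
    have "s \<ge> c" using cInf_lower[OF s(1) S(2)] by (simp add: c_def)
    then show False using d(2)[of s] s \<open>y c > 0\<close> by (cases "s = c") (auto simp: S_def dist_real_def)
  qed
  then have "D c > 0" using touch c by simp
  then obtain d where d: "d > 0" "\<And>s. 0 \<le> s \<Longrightarrow> dist s c < d \<Longrightarrow> D s > 0"
  proof -
    obtain d where d: "d > 0" "\<And>s. s \<in> {0..} \<Longrightarrow> dist s c < d \<Longrightarrow> dist (D s) (D c) < D c"
      using D c \<open>D c > 0\<close> unfolding continuous_on_iff by (meson atLeast_iff)
    have "D s > 0" if "0 \<le> s" "dist s c < d" for s
      using d(2)[of s] that by (simp add: dist_real_def)
    then show ?thesis using that d(1) by blast
  qed
  obtain s where s: "s \<in> S" "s < c + d" using near[OF d(1)] by auto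
  have "s \<ge> c" using cInf_lower[OF s(1) S(2)] by (simp add: c_def)
  have "frac_integral a (\<lambda>u. D (c + u)) (s - c) \<le> y (c + (s - c))"
  proof (rule frac_restart[OF a, of "s + 1" D y y0])
    show "y u \<ge> 0" if "0 \<le> u" "u \<le> c" for u
      using before[of u] yc that by (cases "u = c") auto
  qed (use y y0 c \<open>s \<ge> c\<close> in \<open>auto intro: continuous_on_subset[OF D]\<close>)
  moreover have "0 \<le> frac_integral a (\<lambda>u. D (c + u)) (s - c)"
  proof -
    have "frac_integral a (\<lambda>u. 0) (s - c) \<le> frac_integral a (\<lambda>u. D (c + u)) (s - c)"
    proof (rule frac_integral_mono[OF a(1)])
      show "0 \<le> D (c + u)" if "0 < u" "u < s - c" for u
        using d(2)[of "c + u"] that c s by (simp add: dist_real_def)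
    qed (use a c \<open>s \<ge> c\<close> in \<open>auto intro!: frac_integrable_continuous continuous_intros continuous_on_compose2[OF D]\<close>)
    then show ?thesis using frac_integral_const[OF a(1), of "s - c" 0] \<open>s \<ge> c\<close> by simp
  qed
  ultimately show False using s by (simp add: S_def)
qed

text \<open>
  Adding \<open>e * (1 + t powr a / Gamma (a + 1))\<close>, whose Caputo derivative is the constant \<open>e\<close>,
  reduces the weak sign condition to the strict one.
\<close>

lemma frac_nonneg:
  assumes a: "0 < a" "a \<le> 1" and D: "continuous_on {0..} D"
    and y: "\<And>t. 0 \<le> t \<Longrightarrow> y t = y0 + frac_integral a D t" and y0: "y0 \<ge> 0"
    and neg: "\<And>t. 0 \<le> t \<Longrightarrow> y t < 0 \<Longrightarrow> D t \<ge> 0"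
    and t: "0 \<le> t"
  shows "y t \<ge> 0"
proof -
  let ?G = "Gamma (a + 1)"
  have G: "?G > 0" using a by (intro Gamma_real_pos) simp
  have le: "0 \<le> y t + e * (1 + t powr a / ?G)" if e: "e > 0" for e
  proof (rule frac_comparison[OF a _ _ _ _ t])
    show "continuous_on {0..} (\<lambda>s. D s + e)" by (intro continuous_intros D)
    show "y s + e * (1 + s powr a / ?G) = (y0 + e) + frac_integral a (\<lambda>s. D s + e) s" if "0 \<le> s" for s
      using that a y[of s] frac_integral_const[OF a(1) that, of e]
        frac_integral_add[OF a(1), of D s "\<lambda>s. e"]
      by (simp add: frac_integrable_continuous continuous_on_subset[OF D] algebra_simps)
    show "D s + e > 0" if s: "0 \<le> s" "y s + e * (1 + s powr a / ?G) = 0" for s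
    proof -
      have "e * (1 + s powr a / ?G) > 0" using e G by (intro mult_pos_pos) (auto intro: add_pos_nonneg)
      then show ?thesis using neg[of s] s e by simp
    qed
  qed (use y0 e in simp)
  show ?thesis
  proof (rule field_le_epsilon)
    fix e :: real assume e: "e > 0"
    have "1 + t powr a / ?G > 0" using G by (intro add_pos_nonneg) auto
    then show "0 \<le> y t + e" using le[of "e / (1 + t powr a / ?G)"] e by simp
  qed
qed

section \<open>Volterra systems\<close>

text \<open>
  With the weight \<open>exp (\<lambda> t)\<close>, fractional integration gains the factor \<open>\<lambda> powr (- a)\<close>, so for large
  \<open>\<lambda>\<close> a Volterra operator with Lipschitz right-hand side is a contraction on the whole half-line.
\<close>

lemma frac_integral_exp_le:
  assumes a: "a > 0" and l: "l > 0" and t: "t \<ge> 0" and x: "continuous_on {0..t} x"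
    and le: "\<And>s. 0 \<le> s \<Longrightarrow> s \<le> t \<Longrightarrow> \<bar>x s\<bar> \<le> C * exp (l * s)"
  shows "\<bar>frac_integral a x t\<bar> \<le> C * exp (l * t) * l powr (- a)"
proof -
  define K :: "real \<Rightarrow> real" where "K = (\<lambda>u. indicator {0..} u * u powr (a - 1) / exp u)"
  have "has_bochner_integral lborel K (Gamma a)"
  proof (rule has_bochner_integral_nn_integral)
    show "(\<integral>\<^sup>+ u. ennreal (K u) \<partial>lborel) = ennreal (Gamma a)"
      using Gamma_conv_nn_integral_real[OF a] by (simp add: K_def)
  qed (use Gamma_real_pos[OF a] in \<open>auto simp: K_def\<close>)
  then have K: "integrable lborel K" "integral\<^sup>L lborel K = Gamma a"
    by (auto simp: has_bochner_integral_iff)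
  have K': "integrable lborel (\<lambda>s. K (l * t + (- l) * s))"
    by (rule lborel_integrable_real_affine[OF K(1)]) (use l in simp)
  have val: "(\<integral>s. K (l * t + (- l) * s) \<partial>lborel) = Gamma a / l"
    using lborel_integral_real_affine[of "- l" K "l * t"] K(2) l by (simp add: field_simps)
  have C: "C \<ge> 0" using le[of 0] t by simp
  let ?e = "\<lambda>s. C * exp (l * s)"
  have ie: "frac_integrable a ?e t"
    by (intro frac_integrable_continuous a t continuous_intros)
  have "(LINT s:{0..t}|lborel. (t - s) powr (a - 1) * ?e s)
      \<le> (\<integral>s. C * exp (l * t) * l powr (1 - a) * K (l * t + (- l) * s) \<partial>lborel)"
    unfolding set_lebesgue_integral_def
  proof (rule integral_mono)
    show "integrable lborel (\<lambda>s. indicat_real {0..t} s *\<^sub>R ((t - s) powr (a - 1) * ?e s))"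
      using ie by (simp add: frac_integrable_def set_integrable_def)
    show "integrable lborel (\<lambda>s. C * exp (l * t) * l powr (1 - a) * K (l * t + (- l) * s))"
      by (intro integrable_mult_right K')
    fix s :: real
    show "indicat_real {0..t} s *\<^sub>R ((t - s) powr (a - 1) * ?e s)
        \<le> C * exp (l * t) * l powr (1 - a) * K (l * t + (- l) * s)"
    proof (cases "s \<in> {0..t}")
      case True
      have "K (l * t + (- l) * s) = (l * (t - s)) powr (a - 1) / exp (l * (t - s))"
        using True l by (simp add: K_def algebra_simps)
      also have "\<dots> = l powr (a - 1) * (t - s) powr (a - 1) * (exp (l * s) / exp (l * t))"
        using True l by (simp add: powr_mult exp_diff) (simp add: right_diff_distrib exp_diff)
      finally have "C * exp (l * t) * l powr (1 - a) * K (l * t + (- l) * s)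
          = C * (l powr (1 - a) * l powr (a - 1)) * (t - s) powr (a - 1) * exp (l * s)" by simp
      also have "l powr (1 - a) * l powr (a - 1) = 1" using l by (simp flip: powr_add)
      finally have "C * exp (l * t) * l powr (1 - a) * K (l * t + (- l) * s)
          = (t - s) powr (a - 1) * ?e s" by simp
      then show ?thesis using True by (simp only:) simp
    qed (use C in \<open>simp add: K_def\<close>)
  qed
  also have "\<dots> = Gamma a * (C * exp (l * t) * l powr (- a))"
    using val l by (simp add: powr_diff powr_minus field_simps)
  finally have up: "frac_integral a ?e t \<le> C * exp (l * t) * l powr (- a)"
    using a Gamma_real_pos[OF a] by (simp add: frac_integral_def divide_le_eq mult.commute)
  have ix: "frac_integrable a x t" by (intro frac_integrable_continuous a t x)
  have im: "frac_integrable a (\<lambda>s. - 1 * ?e s) t"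
    by (intro frac_integrable_continuous a t continuous_intros)
  have "frac_integral a x t \<le> frac_integral a ?e t"
    by (rule frac_integral_mono[OF a ix ie]) (use le in \<open>meson abs_le_D1 less_imp_le\<close>)
  moreover have "frac_integral a (\<lambda>s. - 1 * ?e s) t \<le> frac_integral a x t"
  proof (rule frac_integral_mono[OF a im ix])
    fix s assume "0 < s" "s < t"
    then show "- 1 * ?e s \<le> x s" using le[of s] by simp
  qed
  moreover have "frac_integral a (\<lambda>s. - 1 * ?e s) t = - frac_integral a ?e t"
    by (simp only: frac_integral_cmult)
  ultimately show ?thesis using up by linarith
qed

lemma weight_exists:
  fixes \<alpha> :: "real ^ 'n"
  assumes "\<And>i. 0 < \<alpha> $ i"
  shows "\<exists>l>0. (\<Sum>i\<in>UNIV. L * l powr (- \<alpha> $ i)) \<le> 1 / 2"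
proof -
  have "((\<lambda>l. \<Sum>i\<in>UNIV. L * l powr (- \<alpha> $ i)) \<longlongrightarrow> (\<Sum>i\<in>(UNIV::'n set). L * 0)) at_top"
    by (intro tendsto_intros tendsto_neg_powr filterlim_ident) (use assms in auto)
  then have "\<forall>\<^sub>F l in at_top. (\<Sum>i\<in>UNIV. L * l powr (- \<alpha> $ i)) < 1 / 2"
    by (rule order_tendstoD) simp
  then have "\<forall>\<^sub>F l in at_top. 0 < l \<and> (\<Sum>i\<in>UNIV. L * l powr (- \<alpha> $ i)) < 1 / 2"
    using eventually_gt_at_top[of 0] by eventually_elim simp
  then show ?thesis by (auto dest!: eventually_happens intro: less_imp_le)
qed

lemma vec_frac_integral_exp_le:
  fixes \<alpha> :: "real ^ 'n" and x :: "real \<Rightarrow> real ^ 'n"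
  assumes \<alpha>: "\<And>i. 0 < \<alpha> $ i" and l: "l > 0" "(\<Sum>i\<in>UNIV. L * l powr (- \<alpha> $ i)) \<le> 1 / 2"
    and t: "t \<ge> 0" and x: "continuous_on {0..t} x" and C: "C \<ge> 0"
    and le: "\<And>s. 0 \<le> s \<Longrightarrow> s \<le> t \<Longrightarrow> norm (x s) \<le> L * (C * exp (l * s))"
  shows "norm (\<chi> i. frac_integral (\<alpha> $ i) (\<lambda>s. x s $ i) t) \<le> 1 / 2 * C * exp (l * t)"
proof -
  have "norm (\<chi> i. frac_integral (\<alpha> $ i) (\<lambda>s. x s $ i) t)
      \<le> (\<Sum>i\<in>UNIV. \<bar>frac_integral (\<alpha> $ i) (\<lambda>s. x s $ i) t\<bar>)"
    using norm_le_l1_cart[of "\<chi> i. frac_integral (\<alpha> $ i) (\<lambda>s. x s $ i) t"] by simp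
  also have "\<dots> \<le> (\<Sum>i\<in>UNIV. (L * C) * exp (l * t) * l powr (- \<alpha> $ i))"
  proof (rule sum_mono)
    fix i
    show "\<bar>frac_integral (\<alpha> $ i) (\<lambda>s. x s $ i) t\<bar> \<le> (L * C) * exp (l * t) * l powr (- \<alpha> $ i)"
    proof (rule frac_integral_exp_le[OF \<alpha> l(1) t continuous_on_component[OF x]])
      fix s assume "0 \<le> s" "s \<le> t"
      from order_trans[OF component_le_norm_cart le[OF this]]
      show "\<bar>x s $ i\<bar> \<le> (L * C) * exp (l * s)" by (simp add: mult.assoc)
    qed
  qed
  also have "\<dots> = (\<Sum>i\<in>UNIV. L * l powr (- \<alpha> $ i)) * (C * exp (l * t))"
    unfolding sum_distrib_right by (rule sum.cong) (simp_all add: mult_ac)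
  also have "\<dots> \<le> 1 / 2 * (C * exp (l * t))"
    by (rule mult_right_mono[OF l(2)]) (use C in simp)
  finally show ?thesis by simp
qed

text \<open>The maximum of \<open>exp (- l s) * norm (e s)\<close> is at most half of itself.\<close>

lemma volterra_unique:
  fixes \<alpha> :: "real ^ 'n" and e \<delta> :: "real \<Rightarrow> real ^ 'n"
  assumes \<alpha>: "\<And>i. 0 < \<alpha> $ i" and e: "continuous_on {0..b} e" and \<delta>: "continuous_on {0..b} \<delta>"
    and eq: "\<And>t i. 0 \<le> t \<Longrightarrow> t \<le> b \<Longrightarrow> e t $ i = frac_integral (\<alpha> $ i) (\<lambda>s. \<delta> s $ i) t"
    and lip: "\<And>t c. 0 \<le> t \<Longrightarrow> t \<le> b \<Longrightarrow> 0 \<le> c \<Longrightarrow> (\<And>s. 0 \<le> s \<Longrightarrow> s \<le> t \<Longrightarrow> norm (e s) \<le> c)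
        \<Longrightarrow> norm (\<delta> t) \<le> L * c"
    and t: "0 \<le> t" "t \<le> b"
  shows "e t = 0"
proof -
  obtain l where l: "l > 0" "(\<Sum>i\<in>UNIV. L * l powr (- \<alpha> $ i)) \<le> 1 / 2"
    using weight_exists[of \<alpha> L] \<alpha> by blast
  let ?w = "\<lambda>s. exp (- l * s) * norm (e s)"
  have "continuous_on {0..b} ?w" by (intro continuous_intros e)
  then obtain s0 where s0: "s0 \<in> {0..b}" "\<And>s. s \<in> {0..b} \<Longrightarrow> ?w s \<le> ?w s0"
    using continuous_attains_sup[of "{0..b}" ?w] t by auto
  have weigh: "norm (e s) \<le> ?w s0 * exp (l * s)" if "s \<in> {0..b}" for s
  proof -
    have "norm (e s) = ?w s * exp (l * s)" by (simp add: exp_minus)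
    also have "\<dots> \<le> ?w s0 * exp (l * s)" by (rule mult_right_mono[OF s0(2)[OF that]]) simp
    finally show ?thesis .
  qed
  have "norm (\<chi> i. frac_integral (\<alpha> $ i) (\<lambda>s. \<delta> s $ i) s0) \<le> 1 / 2 * ?w s0 * exp (l * s0)"
  proof (rule vec_frac_integral_exp_le[OF \<alpha> l])
    fix s assume s: "0 \<le> s" "s \<le> s0"
    show "norm (\<delta> s) \<le> L * (?w s0 * exp (l * s))"
    proof (rule lip)
      fix u assume u: "0 \<le> u" "u \<le> s"
      have "norm (e u) \<le> ?w s0 * exp (l * u)" by (rule weigh) (use u s s0 in auto)
      also have "\<dots> \<le> ?w s0 * exp (l * s)" using u l by (intro mult_left_mono) auto
      finally show "norm (e u) \<le> ?w s0 * exp (l * s)" .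
    qed (use s s0 in auto)
  qed (use s0 in \<open>auto intro: continuous_on_subset[OF \<delta>]\<close>)
  moreover have "(\<chi> i. frac_integral (\<alpha> $ i) (\<lambda>s. \<delta> s $ i) s0) = e s0"
    using eq s0 by (simp add: vec_eq_iff)
  moreover have "?w s0 * exp (l * s0) = norm (e s0)" by (simp add: exp_minus)
  ultimately have "norm (e s0) \<le> 1 / 2 * norm (e s0)" by (simp only: mult.assoc)
  then have "?w s0 = 0" by simp
  then show ?thesis using weigh[of t] t by simp
qed

text \<open>
  The unknown of the fixed point problem is \<open>exp (- l t) (w t - \<phi> 0)\<close>, a bounded continuous
  function on the line that is constant on the negative half-line. It vanishes at \<open>0\<close> for the fixed
  point, which makes \<open>w\<close> agree with \<open>\<phi>\<close> there.
\<close>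

lemma volterra_exists:
  fixes \<alpha> :: "real ^ 'n" and N :: "(real \<Rightarrow> real ^ 'n) \<Rightarrow> real \<Rightarrow> real ^ 'n"
  assumes \<alpha>: "\<And>i. 0 < \<alpha> $ i" and \<phi>: "continuous_on UNIV \<phi>" and L: "L > 0"
    and cont: "\<And>w. continuous_on UNIV w \<Longrightarrow> continuous_on {0..} (N w)"
    and bdd: "\<And>w t. t \<ge> 0 \<Longrightarrow> norm (N w t) \<le> B"
    and lip: "\<And>w w' t c. t \<ge> 0 \<Longrightarrow> (\<And>s. s \<le> t \<Longrightarrow> norm (w s - w' s) \<le> c)
        \<Longrightarrow> norm (N w t - N w' t) \<le> L * c"
  shows "\<exists>w. continuous_on UNIV w \<and> (\<forall>t\<le>0. w t = \<phi> t) \<and>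
    (\<forall>t\<ge>0. \<forall>i. w t $ i = \<phi> 0 $ i + frac_integral (\<alpha> $ i) (\<lambda>s. N w s $ i) t)"
proof -
  obtain l where l: "l > 0" "(\<Sum>i\<in>UNIV. L * l powr (- \<alpha> $ i)) \<le> 1 / 2"
    using weight_exists[of \<alpha> L] \<alpha> by blast
  have B: "B \<ge> 0" using order_trans[OF norm_ge_zero bdd[of 0]] by simp
  define W where "W = (\<lambda>v :: real \<Rightarrow>\<^sub>C (real ^ 'n). \<lambda>t. \<phi> (min t 0) + exp (l * max t 0) *\<^sub>R v (max t 0))"
  have cv: "continuous_on S (apply_bcontfun v)" for S and v :: "real \<Rightarrow>\<^sub>C (real ^ 'n)"
    using apply_bcontfun[of v] by (auto simp: bcontfun_def intro: continuous_on_subset)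
  have cW: "continuous_on UNIV (W v)" for v
    unfolding W_def
    by (intro continuous_intros continuous_on_compose2[OF \<phi>] continuous_on_compose2[OF cv[of UNIV]]) auto
  define I where "I = (\<lambda>(x :: real \<Rightarrow> real ^ 'n) t. \<chi> i. frac_integral (\<alpha> $ i) (\<lambda>s. x s $ i) t)"
  define T where "T = (\<lambda>v t. exp (- l * max t 0) *\<^sub>R I (N (W v)) (max t 0))"
  have cN: "continuous_on {0..t} (N (W v))" for t v
    using cont[OF cW] by (rule continuous_on_subset) auto
  have T: "T v \<in> bcontfun" for v
  proof -
    have "continuous_on {0..t} (I (N (W v)))" for t
      unfolding I_def
      by (intro continuous_on_vec_lambda continuous_on_frac_integral continuous_on_component cN
          less_imp_le[OF \<alpha>])
    then have "continuous_on {0..} (I (N (W v)))" by (rule continuous_on_atLeast_if_Icc)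
    then have "continuous_on UNIV (\<lambda>t. I (N (W v)) (max t 0))"
      by (rule continuous_on_compose2) (auto intro!: continuous_intros)
    then have "continuous_on UNIV (T v)"
      unfolding T_def by (intro continuous_intros)
    moreover have "norm (T v t) \<le> 1 / 2 * (B / L)" for t
    proof -
      have "norm (I (N (W v)) (max t 0)) \<le> 1 / 2 * (B / L) * exp (l * max t 0)"
        unfolding I_def
      proof (rule vec_frac_integral_exp_le[OF \<alpha> l _ cN])
        fix s :: real assume s: "0 \<le> s"
        have "norm (N (W v) s) \<le> B * 1" using bdd[OF s] by simp
        also have "\<dots> \<le> B * exp (l * s)" using B s l by (intro mult_left_mono) auto
        finally show "norm (N (W v) s) \<le> L * (B / L * exp (l * s))" using L by simp
      qed (use B L in auto)
      then have "exp (- l * max t 0) * norm (I (N (W v)) (max t 0))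
          \<le> exp (- l * max t 0) * (1 / 2 * (B / L) * exp (l * max t 0))"
        by (rule mult_left_mono) simp
      then have "norm (T v t) \<le> exp (- l * max t 0) * (1 / 2 * (B / L) * exp (l * max t 0))"
        by (simp only: T_def norm_scaleR abs_exp_cancel)
      also have "\<dots> = 1 / 2 * (B / L)" by (simp add: exp_minus)
      finally show ?thesis .
    qed
    ultimately show ?thesis by (auto simp: bcontfun_def bounded_iff)
  qed
  have "\<exists>!v. Bcontfun (T v) = v"
  proof (rule banach_fix_type)
    show "\<forall>v v'. dist (Bcontfun (T v)) (Bcontfun (T v')) \<le> 1 / 2 * dist v v'"
    proof (intro allI dist_bound)
      fix v v' :: "real \<Rightarrow>\<^sub>C (real ^ 'n)" and t :: real
      let ?t = "max t 0"
      have "norm (I (\<lambda>s. N (W v) s - N (W v') s) ?t) \<le> 1 / 2 * dist v v' * exp (l * ?t)"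
        unfolding I_def
      proof (rule vec_frac_integral_exp_le[OF \<alpha> l])
        fix s :: real assume s: "0 \<le> s" "s \<le> ?t"
        show "norm (N (W v) s - N (W v') s) \<le> L * (dist v v' * exp (l * s))"
        proof (rule lip[OF s(1)])
          fix u :: real assume u: "u \<le> s"
          have "norm (W v u - W v' u) = exp (l * max u 0) * dist (v (max u 0)) (v' (max u 0))"
            by (simp add: W_def dist_norm flip: scaleR_diff_right)
          also have "\<dots> \<le> exp (l * s) * dist v v'"
            using u s l by (intro mult_mono dist_bounded) auto
          finally show "norm (W v u - W v' u) \<le> dist v v' * exp (l * s)" by (simp add: mult.commute)
        qed
      qed (auto intro!: continuous_intros cN)
      moreover have "I (\<lambda>s. N (W v) s - N (W v') s) ?t = I (N (W v)) ?t - I (N (W v')) ?t"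
        unfolding I_def
        by (simp add: vec_eq_iff frac_integral_diff_continuous \<alpha> less_imp_le continuous_on_component cN)
      ultimately have "norm (I (N (W v)) ?t - I (N (W v')) ?t) \<le> 1 / 2 * dist v v' * exp (l * ?t)" by simp
      then have "exp (- l * ?t) * norm (I (N (W v)) ?t - I (N (W v')) ?t)
          \<le> exp (- l * ?t) * (1 / 2 * dist v v' * exp (l * ?t))" by (rule mult_left_mono) simp
      also have "\<dots> = 1 / 2 * dist v v'" by (simp add: exp_minus)
      finally show "dist (Bcontfun (T v) t) (Bcontfun (T v') t) \<le> 1 / 2 * dist v v'"
        by (simp add: Bcontfun_inverse T) (simp add: T_def dist_norm flip: scaleR_diff_right)
    qed
  qed auto
  then obtain v where "Bcontfun (T v) = v" by blast
  then have "apply_bcontfun v = T v" using Bcontfun_inverse[OF T, of v] by simp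
  moreover define Z where "Z = N (W v)"
  ultimately have v: "apply_bcontfun v = (\<lambda>t. exp (- l * max t 0) *\<^sub>R I Z (max t 0))"
    by (simp only: T_def)
  have I0: "I x 0 = 0" for x using \<alpha> by (simp add: I_def vec_eq_iff)
  have neg: "W v t = \<phi> t" if "t \<le> 0" for t
    using that by (simp add: W_def v I0)
  have pos: "W v t = \<phi> 0 + I Z t" if "t \<ge> 0" for t
    using that by (simp add: W_def v exp_minus)
  have "W v t $ i = \<phi> 0 $ i + frac_integral (\<alpha> $ i) (\<lambda>s. N (W v) s $ i) t" if "t \<ge> 0" for t i
    using pos[OF that] by (simp add: I_def Z_def)
  then show ?thesis using cW neg by blast
qed

section \<open>Power barriers and the Mittag-Leffler function\<close>

lemma frac_integral_1_FTC:
  assumes "t \<ge> 0" "\<And>s. s \<in> {0..t} \<Longrightarrow> (z has_real_derivative z' s) (at s)" "continuous_on {0..t} z'"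
  shows "frac_integral 1 z' t = z t - z 0"
proof -
  have "(z' has_integral (z t - z 0)) {0..t}"
    by (rule fundamental_theorem_of_calculus)
       (use assms in \<open>auto simp flip: has_real_derivative_iff_has_vector_derivative intro: has_field_derivative_at_within\<close>)
  then show ?thesis using frac_integral_1[OF assms(1,3)] by (simp add: integral_unique)
qed

lemma shifted_power_volterra:
  assumes A: "A > 0" and a: "0 < a" "a \<le> 1" and t: "t \<ge> 0"
  shows "(A + t) powr (- \<gamma>) = A powr (- \<gamma>)
      + frac_integral a (\<lambda>s. - \<gamma> * frac_integral (1 - a) (\<lambda>u. (A + u) powr (- \<gamma> - 1)) s) t"
proof -
  let ?z = "\<lambda>u. (A + u) powr (- \<gamma>)" and ?z' = "\<lambda>u. (A + u) powr (- \<gamma> - 1)"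
  have c: "continuous_on {0..s} ?z'" for s
    by (intro continuous_intros) (use A in auto)
  have "frac_integral a (\<lambda>s. - \<gamma> * frac_integral (1 - a) ?z' s) t
      = - \<gamma> * frac_integral a (frac_integral (1 - a) ?z') t"
    by (rule frac_integral_cmult)
  also have "frac_integral a (frac_integral (1 - a) ?z') t = frac_integral 1 ?z' t"
    using frac_integral_semigroup[OF _ _ t c, of a "1 - a"] a by simp
  also have "- \<gamma> * frac_integral 1 ?z' t = frac_integral 1 (\<lambda>s. - \<gamma> * ?z' s) t"
    by (rule frac_integral_cmult[symmetric])
  also have "\<dots> = ?z t - ?z 0"
  proof (rule frac_integral_1_FTC[OF t])
    show "(?z has_real_derivative - \<gamma> * ?z' s) (at s)" if "s \<in> {0..t}" for s
      using that A by (auto intro!: derivative_eq_intros)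
  qed (intro continuous_intros c)
  finally show ?thesis by simp
qed

text \<open>
  For \<open>a < 1\<close> the order-\<open>a\<close> Caputo derivative of \<open>(A + t) powr (- \<gamma>)\<close> has size \<open>t powr (- a)\<close> for
  large \<open>t\<close>, whatever \<open>\<gamma>\<close> is, because the initial drop is never forgotten. It is thus dominated by
  \<open>(A + t) powr (- \<sigma>)\<close> for \<open>\<sigma> < a\<close>, and the factor in front becomes small for a large shift \<open>A\<close>;
  this is what lets such a power serve as a barrier.
\<close>

lemma shifted_power_bound:
  assumes a: "0 < a" "a \<le> 1" and \<sigma>: "0 < \<sigma>" "\<sigma> < a" and \<gamma>: "\<gamma> > 0"
  shows "\<exists>C>0. \<forall>A>0. \<forall>t\<ge>0. frac_integral (1 - a) (\<lambda>u. (A + u) powr (- \<gamma> - 1)) t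
            \<le> C * A powr (- (\<gamma> + a - \<sigma>)) * (A + t) powr (- \<sigma>)"
proof (cases "a = 1")
  case True
  have "(A + t) powr (- \<gamma> - 1) \<le> 1 * A powr (- (\<gamma> + a - \<sigma>)) * (A + t) powr (- \<sigma>)"
    if "A > 0" "t \<ge> 0" for A t :: real
  proof -
    have "(A + t) powr (- \<gamma> - 1) = (A + t) powr (- (\<gamma> + a - \<sigma>)) * (A + t) powr (- \<sigma>)"
      using True by (simp flip: powr_add)
    also have "\<dots> \<le> A powr (- (\<gamma> + a - \<sigma>)) * (A + t) powr (- \<sigma>)"
      using that \<sigma> \<gamma> by (intro mult_right_mono powr_mono2') auto
    finally show ?thesis by simp
  qed
  then show ?thesis using True by (intro exI[of _ 1]) auto
next
  case False
  then have a1: "0 < 1 - a" using a by simp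
  define C where "C = max (Gamma a) (Gamma (a - \<sigma>) / Gamma (1 - \<sigma>)) * 2 powr \<sigma>"
  have G: "Gamma a > 0" "Gamma (a - \<sigma>) > 0" "Gamma (1 - \<sigma>) > 0"
    using a \<sigma> by (auto intro!: Gamma_real_pos)
  (* Splitting the power between A and u leaves a Beta integral; b = a serves for t \<le> A and
     b = a - \<sigma> for t > A. *)
  have bound: "frac_integral (1 - a) (\<lambda>u. (A + u) powr (- \<gamma> - 1)) t
      \<le> Gamma b / Gamma (1 - a + b) * A powr (- \<gamma> - b) * t powr (b - a)"
    if A: "A > 0" and t: "t \<ge> 0" and b: "0 < b" "b \<le> 1" for A t b :: real
  proof -
    have "frac_integral (1 - a) (\<lambda>u. (A + u) powr (- \<gamma> - 1)) t
        \<le> frac_integral (1 - a) (\<lambda>u. A powr (- \<gamma> - b) * u powr (b - 1)) t"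
    proof (rule frac_integral_mono[OF a1])
      show "frac_integrable (1 - a) (\<lambda>u. (A + u) powr (- \<gamma> - 1)) t"
        by (intro frac_integrable_continuous a1 t continuous_intros) (use A in auto)
      show "frac_integrable (1 - a) (\<lambda>u. A powr (- \<gamma> - b) * u powr (b - 1)) t"
        using frac_integrable_powr[OF a1 b(1) t] unfolding frac_integrable_def
        by (subst mult.left_commute, intro set_integrable_mult_right) simp
      fix u :: real assume u: "0 < u"
      have "(A + u) powr (- \<gamma> - 1) = (A + u) powr (- \<gamma> - b) * (A + u) powr (b - 1)"
        by (simp flip: powr_add)
      also have "\<dots> \<le> A powr (- \<gamma> - b) * u powr (b - 1)"
        using A u b \<gamma> by (intro mult_mono powr_mono2') auto
      finally show "(A + u) powr (- \<gamma> - 1) \<le> A powr (- \<gamma> - b) * u powr (b - 1)" .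
    qed
    also have "\<dots> = Gamma b / Gamma (1 - a + b) * A powr (- \<gamma> - b) * t powr (b - a)"
      unfolding frac_integral_cmult frac_integral_powr[OF a1 b(1) t] by (simp add: algebra_simps)
    finally show ?thesis .
  qed
  have "frac_integral (1 - a) (\<lambda>u. (A + u) powr (- \<gamma> - 1)) t
            \<le> C * A powr (- (\<gamma> + a - \<sigma>)) * (A + t) powr (- \<sigma>)"
    if A: "A > 0" and t: "t \<ge> 0" for A t :: real
  proof (cases "t \<le> A")
    case True
    have "frac_integral (1 - a) (\<lambda>u. (A + u) powr (- \<gamma> - 1)) t \<le> Gamma a * A powr (- \<gamma> - a)"
    proof -
      have "t powr 0 \<le> 1" using t by (cases "t = 0") auto
      then have "Gamma a * A powr (- \<gamma> - a) * t powr 0 \<le> Gamma a * A powr (- \<gamma> - a)"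
        using G by (intro mult_left_le) auto
      then show ?thesis using bound[OF A t a] by simp
    qed
    also have "A powr (- \<gamma> - a) = A powr (- (\<gamma> + a - \<sigma>)) * A powr (- \<sigma>)"
      by (simp flip: powr_add)
    also have "A powr (- \<sigma>) = 2 powr \<sigma> * (2 * A) powr (- \<sigma>)"
      using A by (simp add: powr_mult powr_minus)
    also have "Gamma a * (A powr (- (\<gamma> + a - \<sigma>)) * (2 powr \<sigma> * (2 * A) powr (- \<sigma>)))
       \<le> max (Gamma a) (Gamma (a - \<sigma>) / Gamma (1 - \<sigma>)) * (A powr (- (\<gamma> + a - \<sigma>)) * (2 powr \<sigma> * (A + t) powr (- \<sigma>)))"
    proof (rule mult_mono)
      have "(2 * A) powr (- \<sigma>) \<le> (A + t) powr (- \<sigma>)"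
        using A t True \<sigma> by (intro powr_mono2') auto
      then show "A powr (- (\<gamma> + a - \<sigma>)) * (2 powr \<sigma> * (2 * A) powr (- \<sigma>))
          \<le> A powr (- (\<gamma> + a - \<sigma>)) * (2 powr \<sigma> * (A + t) powr (- \<sigma>))"
        by (intro mult_left_mono) auto
    qed (use G in \<open>auto simp: le_max_iff_disj\<close>)
    finally show ?thesis by (simp add: C_def mult_ac)
  next
    case False
    have "frac_integral (1 - a) (\<lambda>u. (A + u) powr (- \<gamma> - 1)) t
        \<le> Gamma (a - \<sigma>) / Gamma (1 - \<sigma>) * (A powr (- (\<gamma> + a - \<sigma>)) * t powr (- \<sigma>))"
      using bound[OF A t, of "a - \<sigma>"] \<sigma> a by (simp add: algebra_simps)
    also have "t powr (- \<sigma>) = 2 powr \<sigma> * (2 * t) powr (- \<sigma>)"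
      using A False by (simp add: powr_mult powr_minus)
    also have "Gamma (a - \<sigma>) / Gamma (1 - \<sigma>) * (A powr (- (\<gamma> + a - \<sigma>)) * (2 powr \<sigma> * (2 * t) powr (- \<sigma>)))
       \<le> max (Gamma a) (Gamma (a - \<sigma>) / Gamma (1 - \<sigma>)) * (A powr (- (\<gamma> + a - \<sigma>)) * (2 powr \<sigma> * (A + t) powr (- \<sigma>)))"
    proof (rule mult_mono)
      have "(2 * t) powr (- \<sigma>) \<le> (A + t) powr (- \<sigma>)"
        using A t False \<sigma> by (intro powr_mono2') auto
      then show "A powr (- (\<gamma> + a - \<sigma>)) * (2 powr \<sigma> * (2 * t) powr (- \<sigma>))
          \<le> A powr (- (\<gamma> + a - \<sigma>)) * (2 powr \<sigma> * (A + t) powr (- \<sigma>))"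
        by (intro mult_left_mono) auto
    qed (use G in \<open>auto simp: le_max_iff_disj\<close>)
    finally show ?thesis by (simp add: C_def mult_ac)
  qed
  moreover have "C > 0" using G by (simp add: C_def less_max_iff_disj)
  ultimately show ?thesis by blast
qed

text \<open>Euler's integral restricted to \<open>{R..}\<close>.\<close>

lemma Gamma_ge_powr_exp:
  assumes x: "x \<ge> 0" and R: "R > (0::real)"
  shows "R powr x * exp (- R) \<le> Gamma (x + 1)"
proof -
  have "((\<lambda>t. R powr x * exp (- 1 * t)) has_integral R powr x * (exp (- 1 * R) / 1)) {R..}"
    by (intro has_integral_mult_right has_integral_exp_minus_to_infinity) simp
  then have 1: "((\<lambda>t. if t \<in> {R..} then R powr x * exp (- 1 * t) else 0) has_integral R powr x * exp (- R)) {0..}"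
    using R by (subst has_integral_restrict) auto
  have "((\<lambda>t. t powr (x + 1 - 1) / exp t) has_integral Gamma (x + 1)) {0..}"
    by (rule Gamma_integral_real) (use x in simp)
  then show ?thesis
  proof -
    have "(if t \<in> {R..} then R powr x * exp (- 1 * t) else 0) \<le> t powr (x + 1 - 1) / exp t"
      if "t \<in> {0..}" for t
      using x R by (auto simp: exp_minus divide_inverse intro!: mult_right_mono powr_mono2)
    then show ?thesis by (rule has_integral_le[OF 1 \<open>(_ has_integral Gamma (x + 1)) _\<close>])
  qed
qed

lemma summable_mittag_leffler:
  assumes \<beta>: "\<beta> > 0"
  shows "summable (\<lambda>k. x ^ k / Gamma (\<beta> * real k + 1))"
proof (rule summable_comparison_test')
  (* chosen so that the terms are dominated by a geometric series of ratio 1/2 *)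
  define R where "R = (2 * (\<bar>x\<bar> + 1)) powr (1 / \<beta>)"
  have R: "R > 0" by (simp add: R_def)
  have Rb: "R powr \<beta> = 2 * (\<bar>x\<bar> + 1)" using \<beta> by (simp add: R_def powr_powr)
  show "summable (\<lambda>k. exp R * (1 / 2) ^ k)"
    by (intro summable_mult summable_geometric) simp
  fix k :: nat
  have G: "R powr (\<beta> * k) * exp (- R) \<le> Gamma (\<beta> * k + 1)"
    using \<beta> R by (intro Gamma_ge_powr_exp) auto
  have "norm (x ^ k / Gamma (\<beta> * k + 1)) = \<bar>x\<bar> ^ k / Gamma (\<beta> * k + 1)"
    using \<beta> by (simp add: power_abs abs_of_pos Gamma_real_pos add_nonneg_pos)
  also have "\<dots> \<le> \<bar>x\<bar> ^ k / (R powr (\<beta> * k) * exp (- R))"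
    using G R \<beta> by (intro divide_left_mono mult_pos_pos Gamma_real_pos) (auto intro: add_nonneg_pos)
  also have "\<dots> = exp R * (\<bar>x\<bar> / R powr \<beta>) ^ k"
    using R by (simp add: exp_minus powr_power powr_powr[symmetric] power_divide field_simps)
  also have "\<dots> \<le> exp R * (1 / 2) ^ k"
    unfolding Rb by (intro mult_left_mono power_mono) (auto simp: field_simps)
  finally show "norm (x ^ k / Gamma (\<beta> * k + 1)) \<le> exp R * (1 / 2) ^ k" .
qed

lemma frac_integral_uniform_limit:
  assumes a: "a > 0" and t: "t \<ge> 0" and S: "\<And>n. continuous_on {0..t} (S n)"
    and lim: "uniform_limit {0..t} S u sequentially" and u: "continuous_on {0..t} u"
  shows "(\<lambda>n. frac_integral a (S n) t) \<longlonglongrightarrow> frac_integral a u t"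
proof (rule tendstoI)
  fix e :: real assume e: "e > 0"
  define K where "K = t powr a / Gamma (a + 1) + 1"
  have K: "K > 0" "t powr a / Gamma (a + 1) < K"
    using a Gamma_real_pos[of "a + 1"] by (auto simp: K_def intro!: add_nonneg_pos)
  have "\<forall>\<^sub>F n in sequentially. \<forall>s\<in>{0..t}. dist (S n s) (u s) < e / K"
    by (rule uniform_limitD[OF lim]) (use e K in simp)
  then show "\<forall>\<^sub>F n in sequentially. dist (frac_integral a (S n) t) (frac_integral a u t) < e"
  proof eventually_elim
    case (elim n)
    have "dist (frac_integral a (S n) t) (frac_integral a u t) = \<bar>frac_integral a (\<lambda>s. S n s - u s) t\<bar>"
      using frac_integral_diff_continuous[of a t "S n" u] a t S u by (simp add: dist_real_def)
    also have "\<dots> \<le> e / K * t powr a / Gamma (a + 1)"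
      by (rule frac_integral_abs_le[OF a t])
         (use elim S u in \<open>auto intro!: continuous_intros simp: dist_real_def less_imp_le\<close>)
    also have "\<dots> = e / K * (t powr a / Gamma (a + 1))" by simp
    also have "\<dots> < e / K * K"
      using e K by (intro mult_strict_left_mono) auto
    finally show ?case using K by simp
  qed
qed

text \<open>
  \<open>E\<^sub>\<beta>(- c t\<^sup>\<beta>)\<close> solves the linear relaxation equation of order \<open>\<beta>\<close>: integrating a partial sum of
  its series and adding \<open>1\<close> gives exactly the next partial sum.
\<close>

lemma mittag_leffler_volterra:
  assumes \<beta>: "\<beta> > 0" and c: "c \<ge> 0" and T: "T \<ge> 0"
  defines "u \<equiv> \<lambda>t. mittag_leffler \<beta> (- c * t powr \<beta>)"
  shows "continuous_on {0..T} u" and "u T = 1 + frac_integral \<beta> (\<lambda>s. - c * u s) T"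
proof -
  let ?f = "\<lambda>k s. (- c * s powr \<beta>) ^ k / Gamma (\<beta> * real k + 1)"
  define S where "S = (\<lambda>n s. \<Sum>k<n. ?f k s)"
  have Gp: "Gamma (\<beta> * real k + 1) > 0" for k
    using \<beta> by (intro Gamma_real_pos) (auto intro: add_nonneg_pos)
  have lim: "uniform_limit {0..T} S u sequentially"
    unfolding S_def u_def mittag_leffler_def
  proof (rule Weierstrass_m_test)
    show "summable (\<lambda>k. (c * T powr \<beta>) ^ k / Gamma (\<beta> * real k + 1))"
      by (rule summable_mittag_leffler[OF \<beta>])
    show "norm (?f k s) \<le> (c * T powr \<beta>) ^ k / Gamma (\<beta> * real k + 1)" if "s \<in> {0..T}" for k s
    proof -
      have "norm (?f k s) = (c * s powr \<beta>) ^ k / Gamma (\<beta> * real k + 1)"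
        using Gp[of k] c by (simp add: power_abs abs_mult)
      also have "\<dots> \<le> (c * T powr \<beta>) ^ k / Gamma (\<beta> * real k + 1)"
        using Gp[of k] c \<beta> that by (intro divide_right_mono power_mono mult_left_mono powr_mono2) auto
      finally show ?thesis .
    qed
  qed
  have cp: "continuous_on {0..T} (\<lambda>s. (s powr \<beta>) ^ k)" for k
    by (intro continuous_on_power continuous_on_powr' continuous_intros) (use \<beta> in auto)
  have cf: "continuous_on {0..T} (\<lambda>s. ?f k s)" for k
    using continuous_on_mult_left[OF cp, of "(- c) ^ k / Gamma (\<beta> * real k + 1)" k]
    by (simp only: power_mult_distrib times_divide_eq_left)
  have cS: "continuous_on {0..T} (S n)" for n
    unfolding S_def by (intro continuous_on_sum cf)
  show cu: "continuous_on {0..T} u"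
    by (rule uniform_limit_theorem[OF _ lim]) (use cS in auto)
  have pp: "(s powr \<beta>) ^ k = s powr (\<beta> * real k)" if "k > 0" for s :: real and k :: nat
    using powr_power[of s \<beta> k] that by (cases "s = 0") (auto simp: mult.commute power_0_left)
  have pw: "frac_integral \<beta> (\<lambda>s. (s powr \<beta>) ^ k) T
      = Gamma (\<beta> * real k + 1) / Gamma (\<beta> * real (Suc k) + 1) * (T powr \<beta>) ^ Suc k" for k
  proof (cases "k = 0")
    case True
    then show ?thesis using frac_integral_const[OF \<beta> T, of 1] by simp
  next
    case False
    have "frac_integral \<beta> (\<lambda>s. (s powr \<beta>) ^ k) T = frac_integral \<beta> (\<lambda>s. s powr ((\<beta> * real k + 1) - 1)) T"
      by (rule frac_integral_cong) (use T pp False in auto)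
    also have "\<dots> = Gamma (\<beta> * real k + 1) / Gamma (\<beta> + (\<beta> * real k + 1)) * T powr (\<beta> + (\<beta> * real k + 1) - 1)"
      by (rule frac_integral_powr) (use \<beta> T in \<open>auto intro: add_nonneg_pos\<close>)
    also have "T powr (\<beta> + (\<beta> * real k + 1) - 1) = (T powr \<beta>) ^ Suc k"
      unfolding pp[OF zero_less_Suc] by (simp add: algebra_simps)
    finally show ?thesis by (simp add: algebra_simps)
  qed
  have step: "S (Suc n) T = 1 + frac_integral \<beta> (\<lambda>s. - c * S n s) T" for n
  proof -
    have "frac_integral \<beta> (S n) T = (\<Sum>k<n. frac_integral \<beta> (?f k) T)"
      unfolding S_def by (rule frac_integral_sum(1)[OF \<beta>]) (intro frac_integrable_continuous \<beta> T cf)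
    also have "\<dots> = (\<Sum>k<n. (- c) ^ k * (T powr \<beta>) ^ Suc k / Gamma (\<beta> * real (Suc k) + 1))"
    proof (rule sum.cong)
      fix k
      have "frac_integral \<beta> (?f k) T
          = frac_integral \<beta> (\<lambda>s. ((- c) ^ k / Gamma (\<beta> * real k + 1)) * (s powr \<beta>) ^ k) T"
        by (simp only: power_mult_distrib) (simp add: mult_ac)
      also have "\<dots> = ((- c) ^ k / Gamma (\<beta> * real k + 1)) * frac_integral \<beta> (\<lambda>s. (s powr \<beta>) ^ k) T"
        by (rule frac_integral_cmult)
      finally show "frac_integral \<beta> (?f k) T = (- c) ^ k * (T powr \<beta>) ^ Suc k / Gamma (\<beta> * real (Suc k) + 1)"
        unfolding pw using Gp[of k] by simp
    qed simp
    finally have "frac_integral \<beta> (\<lambda>s. - c * S n s) T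
        = - c * (\<Sum>k<n. (- c) ^ k * (T powr \<beta>) ^ Suc k / Gamma (\<beta> * real (Suc k) + 1))"
      by (simp only: frac_integral_cmult)
    also have "\<dots> = (\<Sum>k<n. ?f (Suc k) T)"
      unfolding sum_distrib_left by (rule sum.cong) (simp_all only: power_mult_distrib, simp_all)
    finally show ?thesis by (simp only: S_def sum.lessThan_Suc_shift) simp
  qed
  have "(\<lambda>n. S (Suc n) T) \<longlonglongrightarrow> u T"
    using tendsto_uniform_limitI[OF lim, of T] T by (subst filterlim_sequentially_Suc) auto
  moreover have "(\<lambda>n. S (Suc n) T) \<longlonglongrightarrow> 1 + (- c) * frac_integral \<beta> u T"
    unfolding step frac_integral_cmult
    by (intro tendsto_intros frac_integral_uniform_limit \<beta> T cS lim cu)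
  ultimately show "u T = 1 + frac_integral \<beta> (\<lambda>s. - c * u s) T"
    unfolding frac_integral_cmult by (rule LIMSEQ_unique)
qed

text \<open>The kernel \<open>(t - s) powr (a - 1)\<close> is smallest at \<open>s = 0\<close>.\<close>

lemma frac_integral_ge_mean:
  assumes a: "0 < a" "a \<le> 1" and t: "t > 0" and x: "continuous_on {0..t} x" "\<And>s. 0 \<le> s \<Longrightarrow> x s \<ge> 0"
  shows "t powr (a - 1) / Gamma a * frac_integral 1 x t \<le> frac_integral a x t"
proof -
  have int: "set_integrable lborel {0..t} (\<lambda>s. (t - s) powr (b - 1) * x s)" if "b > 0" for b
    using frac_integrable_continuous[OF that _ x(1)] t by (simp add: frac_integrable_def)
  have "(LINT s:{0..t}|lborel. t powr (a - 1) * ((t - s) powr (1 - 1) * x s))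
      \<le> (LINT s:{0..t}|lborel. (t - s) powr (a - 1) * x s)"
  proof (rule set_integral_mono_AE)
    have "AE s in lborel. s \<noteq> t" by (rule AE_lborel_singleton)
    then show "AE s\<in>{0..t} in lborel. t powr (a - 1) * ((t - s) powr (1 - 1) * x s) \<le> (t - s) powr (a - 1) * x s"
    proof eventually_elim
      case (elim s)
      show ?case
      proof
        assume s: "s \<in> {0..t}"
        have "t powr (a - 1) \<le> (t - s) powr (a - 1)"
          using a s elim by (intro powr_mono2') auto
        moreover have "(t - s) powr (1 - 1) = 1" using elim by simp
        ultimately show "t powr (a - 1) * ((t - s) powr (1 - 1) * x s) \<le> (t - s) powr (a - 1) * x s"
          using x(2)[of s] s by (simp only:) (auto intro: mult_right_mono)
      qed
    qed
  qed (intro set_integrable_mult_right int a zero_less_one)+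
  then have "t powr (a - 1) * frac_integral 1 x t \<le> Gamma a * frac_integral a x t"
    using a Gamma_real_pos[OF a(1)] by (simp add: frac_integral_def less_imp_neq[symmetric])
  then show ?thesis using Gamma_real_pos[OF a(1)] by (simp add: field_simps)
qed

text \<open>
  On \<open>{0..1}\<close> the function stays above \<open>1/2\<close> when \<open>c\<close> is small. Later it cannot touch
  \<open>(1 + t) powr (- \<beta>) / 4\<close> from above: the memory of the initial drop makes the Caputo derivative
  of that power at most a fixed negative multiple of the power itself for \<open>t \<ge> 1\<close>, hence smaller
  than \<open>- c\<close> times it.
\<close>

lemma mittag_leffler_lower_bound:
  assumes \<beta>: "0 < \<beta>" "\<beta> < 1"
  shows "\<exists>c>0. \<forall>t\<ge>0. (1 + t) powr (- \<beta>) / 4 \<le> mittag_leffler \<beta> (- c * t powr \<beta>)"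
proof -
  have G: "Gamma (1 - \<beta>) > 0" "Gamma (\<beta> + 1) > 0" using \<beta> by (auto intro!: Gamma_real_pos)
  have two: "2 powr (- \<beta>) < (1::real)" using \<beta> powr_less_mono[of "- \<beta>" 0 2] by simp
  define c where "c = min (Gamma (\<beta> + 1) / 2) ((1 - 2 powr (- \<beta>)) / Gamma (1 - \<beta>) / 2)"
  have c: "c > 0" "c \<le> Gamma (\<beta> + 1) / 2" "c < (1 - 2 powr (- \<beta>)) / Gamma (1 - \<beta>)"
  proof -
    have *: "(1 - 2 powr (- \<beta>)) / Gamma (1 - \<beta>) > 0" using G two by simp
    show "c > 0" "c \<le> Gamma (\<beta> + 1) / 2" using * G by (auto simp: c_def)
    have "c \<le> (1 - 2 powr (- \<beta>)) / Gamma (1 - \<beta>) / 2" by (simp add: c_def)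
    also have "\<dots> < (1 - 2 powr (- \<beta>)) / Gamma (1 - \<beta>)" using * by simp
    finally show "c < (1 - 2 powr (- \<beta>)) / Gamma (1 - \<beta>)" .
  qed
  define u where "u = (\<lambda>t. mittag_leffler \<beta> (- c * t powr \<beta>))"
  have cu: "continuous_on {0..t} u" for t
    using mittag_leffler_volterra(1)[of \<beta> c t] \<beta> c unfolding u_def by (cases "t \<ge> 0") auto
  have cu': "continuous_on {0..} u"
    by (rule continuous_on_atLeast_if_Icc[OF cu])
  have u: "u t = 1 + frac_integral \<beta> (\<lambda>s. - c * u s) t" if "t \<ge> 0" for t
    using mittag_leffler_volterra(2)[of \<beta> c t] \<beta> c that unfolding u_def by simp
  have pos: "u t \<ge> 0" if "t \<ge> 0" for t
  proof (rule frac_nonneg[OF \<beta>(1) _ _ u zero_le_one _ that])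
    show "continuous_on {0..} (\<lambda>s. - c * u s)" by (intro continuous_intros cu')
    show "- c * u s \<ge> 0" if "u s < 0" for s using that c by (simp add: mult_nonneg_nonpos)
  qed (use \<beta> in auto)
  have le1: "u t \<le> 1" if "t \<ge> 0" for t
  proof -
    have "frac_integral \<beta> (\<lambda>s. - c * u s) t \<le> frac_integral \<beta> (\<lambda>s. 0) t"
      by (rule frac_integral_mono)
         (use \<beta> c pos that in \<open>auto intro!: frac_integrable_continuous continuous_intros cu\<close>)
    then show ?thesis using u[OF that] frac_integral_const[OF \<beta>(1) that, of 0] by simp
  qed
  have half: "u t \<ge> 1 / 2" if t: "0 \<le> t" "t \<le> 1" for t
  proof -
    have "\<bar>frac_integral \<beta> (\<lambda>s. - c * u s) t\<bar> \<le> c * t powr \<beta> / Gamma (\<beta> + 1)"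
      by (rule frac_integral_abs_le)
         (use \<beta> c pos le1 t in \<open>auto intro!: continuous_intros cu simp: abs_mult mult_left_le\<close>)
    also have "\<dots> \<le> (Gamma (\<beta> + 1) / 2) * 1 / Gamma (\<beta> + 1)"
      using G c t \<beta> by (intro divide_right_mono mult_mono powr_le1) auto
    finally show ?thesis using u[OF t(1)] G by simp
  qed
  define \<zeta> where "\<zeta> = (\<lambda>t::real. (1 + t) powr (- \<beta>) / 4)"
  define B where "B = (\<lambda>t. \<beta> * frac_integral (1 - \<beta>) (\<lambda>s. (1 + s) powr (- \<beta> - 1)) t)"
  have cz: "continuous_on {0..} (\<lambda>s. (1 + s) powr (- \<beta> - 1))"
    by (intro continuous_intros) auto
  have cB: "continuous_on {0..} B"
    unfolding B_def using \<beta>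
    by (intro continuous_on_atLeast_if_Icc continuous_intros continuous_on_frac_integral continuous_on_subset[OF cz]) auto
  have B: "(1 - 2 powr (- \<beta>)) / Gamma (1 - \<beta>) * (1 + t) powr (- \<beta>) \<le> B t" if t: "t \<ge> 1" for t
  proof -
    have "frac_integral 1 (\<lambda>s. - \<beta> * (1 + s) powr (- \<beta> - 1)) t = (1 + t) powr (- \<beta>) - (1 + 0) powr (- \<beta>)"
      by (rule frac_integral_1_FTC)
         (use t in \<open>auto intro!: derivative_eq_intros continuous_intros continuous_on_subset[OF cz]\<close>)
    then have *: "\<beta> * frac_integral 1 (\<lambda>s. (1 + s) powr (- \<beta> - 1)) t = 1 - (1 + t) powr (- \<beta>)"
      by (simp only: frac_integral_cmult) simp
    have "(1 + t) powr (- \<beta>) * (1 - 2 powr (- \<beta>)) \<le> t powr (- \<beta>) * (1 - (1 + t) powr (- \<beta>))"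
      using t \<beta> two by (intro mult_mono diff_left_mono powr_mono2') auto
    then have "(1 - 2 powr (- \<beta>)) / Gamma (1 - \<beta>) * (1 + t) powr (- \<beta>)
        \<le> t powr (- \<beta>) * (\<beta> * frac_integral 1 (\<lambda>s. (1 + s) powr (- \<beta> - 1)) t) / Gamma (1 - \<beta>)"
      unfolding * using G by (simp add: divide_right_mono mult.commute)
    also have "\<dots> = \<beta> * (t powr (1 - \<beta> - 1) / Gamma (1 - \<beta>) * frac_integral 1 (\<lambda>s. (1 + s) powr (- \<beta> - 1)) t)"
      by simp
    also have "\<dots> \<le> B t"
      unfolding B_def using \<beta> t
      by (intro mult_left_mono frac_integral_ge_mean continuous_on_subset[OF cz]) auto
    finally show ?thesis .
  qed
  have "\<zeta> t \<le> u t" if t: "t \<ge> 0" for t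
  proof -
    have "0 \<le> u t - \<zeta> t"
    proof (rule frac_comparison[OF \<beta>(1) _ _ _ _ _ t])
      show "continuous_on {0..} (\<lambda>s. - c * u s + B s / 4)"
        by (intro continuous_intros cu' cB) auto
      show "u s - \<zeta> s = 3 / 4 + frac_integral \<beta> (\<lambda>s. - c * u s + B s / 4) s" if s: "0 \<le> s" for s
      proof -
        have "frac_integral \<beta> (\<lambda>s. - c * u s + (1 / 4) * B s) s
            = frac_integral \<beta> (\<lambda>s. - c * u s) s + frac_integral \<beta> (\<lambda>s. (1 / 4) * B s) s"
          by (intro frac_integral_add \<beta> frac_integrable_continuous s continuous_intros cu
              continuous_on_subset[OF cB]) auto
        also have "frac_integral \<beta> (\<lambda>s. (1 / 4) * B s) s = (1 / 4) * frac_integral \<beta> B s"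
          by (rule frac_integral_cmult)
        also have "frac_integral \<beta> B s = 1 - (1 + s) powr (- \<beta>)"
        proof -
          have "(1 + s) powr (- \<beta>) = 1 powr (- \<beta>) + frac_integral \<beta> (\<lambda>s. - 1 * B s) s"
            unfolding B_def using shifted_power_volterra[of 1 \<beta> s \<beta>] \<beta> s by simp
          then show ?thesis by (simp only: frac_integral_cmult) simp
        qed
        finally show ?thesis using u[OF s] by (simp add: \<zeta>_def field_simps)
      qed
      show "- c * u s + B s / 4 > 0" if s: "0 \<le> s" "u s - \<zeta> s = 0" for s
      proof -
        have "\<zeta> s \<le> 1 / 4" using s \<beta> powr_mono2'[of "- \<beta>" 1 "1 + s"] by (simp add: \<zeta>_def)
        then have "s \<ge> 1" using half[of s] s by fastforce
        have "c * u s < (1 - 2 powr (- \<beta>)) / Gamma (1 - \<beta>) * \<zeta> s"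
        proof -
          have "u s = \<zeta> s" "\<zeta> s > 0" using s by (auto simp: \<zeta>_def)
          then show ?thesis using mult_strict_right_mono[OF c(3)] by simp
        qed
        also have "\<dots> \<le> B s / 4" using B[OF \<open>s \<ge> 1\<close>] by (simp add: \<zeta>_def)
        finally show ?thesis by simp
      qed
    qed (use \<beta> in auto)
    then show ?thesis by simp
  qed
  then show ?thesis using c(1) unfolding u_def \<zeta>_def by blast
qed

section \<open>Homogeneous and cooperative vector fields\<close>

lemma homogeneous_zero:
  assumes "homogeneous p h" "p > 0"
  shows "h 0 = 0"
proof -
  have "h (2 *\<^sub>R 0) = (2 powr p) *\<^sub>R h 0"
    using assms(1) unfolding homogeneous_def by (metis zero_less_numeral)
  moreover have "2 powr p \<noteq> (1::real)" using assms(2) by simp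
  ultimately show ?thesis by (metis scaleR_cancel_right scaleR_one scaleR_zero_right)
qed

lemma C1_has_derivative:
  assumes "C1_away_from_0 h" "x \<noteq> 0"
  shows "(h has_derivative (\<lambda>y. jacobian h (at x) *v y)) (at x)"
  using assms unfolding C1_away_from_0_def jacobian_works by blast

lemma homogeneous_jacobian:
  assumes C1: "C1_away_from_0 h" and hom: "homogeneous p h" and x: "x \<noteq> 0" and l: "l > 0"
  shows "jacobian h (at (l *\<^sub>R x)) = (l powr (p - 1)) *\<^sub>R jacobian h (at x)"
proof -
  have inner: "((\<lambda>y. (1 / l) *\<^sub>R y) has_derivative (\<lambda>y. (1 / l) *\<^sub>R y)) (at (l *\<^sub>R x))"
    by (auto intro!: derivative_eq_intros)
  have "(h has_derivative (\<lambda>y. jacobian h (at x) *v y)) (at ((1 / l) *\<^sub>R (l *\<^sub>R x)))"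
    using C1_has_derivative[OF C1 x] l by simp
  from has_derivative_compose[OF inner this]
  have "((\<lambda>y. (l powr p) *\<^sub>R h ((1 / l) *\<^sub>R y)) has_derivative
      (\<lambda>y. (l powr p) *\<^sub>R (jacobian h (at x) *v ((1 / l) *\<^sub>R y)))) (at (l *\<^sub>R x))"
    by (rule has_derivative_scaleR_right)
  moreover have "(l powr p) *\<^sub>R h ((1 / l) *\<^sub>R y) = h y" for y
  proof -
    have "h (l *\<^sub>R ((1 / l) *\<^sub>R y)) = (l powr p) *\<^sub>R h ((1 / l) *\<^sub>R y)"
      using hom l unfolding homogeneous_def by blast
    then show ?thesis using l by simp
  qed
  ultimately have "(h has_derivative (\<lambda>y. (l powr p) *\<^sub>R (jacobian h (at x) *v ((1 / l) *\<^sub>R y)))) (at (l *\<^sub>R x))"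
    by simp
  moreover have "(h has_derivative (\<lambda>y. jacobian h (at (l *\<^sub>R x)) *v y)) (at (l *\<^sub>R x))"
    by (rule C1_has_derivative[OF C1]) (use x l in simp)
  ultimately have eq: "(\<lambda>y. jacobian h (at (l *\<^sub>R x)) *v y)
      = (\<lambda>y. (l powr p) *\<^sub>R (jacobian h (at x) *v ((1 / l) *\<^sub>R y)))"
    by (rule has_derivative_unique[symmetric])
  have "jacobian h (at (l *\<^sub>R x)) *v y = ((l powr (p - 1)) *\<^sub>R jacobian h (at x)) *v y" for y
    using fun_cong[OF eq, of y] l
    by (simp add: matrix_vector_mult_scaleR scaleR_matrix_vector_assoc powr_diff)
  then show ?thesis by (simp add: matrix_eq)
qed

text \<open>
  Degree at least one keeps the derivative bounded near the origin, so the field is Lipschitz on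
  bounded sets even though it need not be differentiable at \<open>0\<close>. A segment through the origin is
  handled by comparing both end points with \<open>h 0 = 0\<close>.
\<close>

lemma homogeneous_lipschitz:
  fixes h :: "real ^ 'n \<Rightarrow> real ^ 'n"
  assumes C1: "C1_away_from_0 h" and cont: "continuous_on UNIV h" and hom: "homogeneous p h"
    and p: "p \<ge> 1"
  shows "\<exists>L\<ge>0. \<forall>x y. norm x \<le> R \<longrightarrow> norm y \<le> R \<longrightarrow> norm (h x - h y) \<le> L * norm (x - y)"
proof -
  have "continuous_on (- {0}) (\<lambda>x. jacobian h (at x))"
    using C1 by (simp add: C1_away_from_0_def)
  then have "continuous_on (sphere 0 1) (\<lambda>x. jacobian h (at x))"
    by (rule continuous_on_subset) auto
  from compact_imp_bounded[OF compact_continuous_image[OF this compact_sphere]]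
  obtain J where J': "\<forall>A\<in>(\<lambda>x. jacobian h (at x)) ` sphere 0 1. norm A \<le> J"
    unfolding bounded_iff by blast
  have J: "norm (jacobian h (at x)) \<le> J" if "norm x = 1" for x
    using J' that by simp
  have "continuous_on (sphere 0 1) h"
    by (rule continuous_on_subset[OF cont]) auto
  from compact_imp_bounded[OF compact_continuous_image[OF this compact_sphere]]
  obtain H where H': "\<forall>z\<in>h ` sphere 0 1. norm z \<le> H"
    unfolding bounded_iff by blast
  have H: "norm (h x) \<le> H" if "norm x = 1" for x
    using H' that by simp
  have e1: "norm (axis undefined 1 :: real ^ 'n) = 1" by simp
  have J0: "J \<ge> 0" and H0: "H \<ge> 0"
    using order_trans[OF norm_ge_zero J[OF e1]] order_trans[OF norm_ge_zero H[OF e1]] by auto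
  define Q where "Q = (max R 0) powr (p - 1)"
  define K where "K = real CARD('n) * real CARD('n) * (Q * J)"
  have unit: "x = norm x *\<^sub>R (x /\<^sub>R norm x)" "norm (x /\<^sub>R norm x) = 1" if "x \<noteq> 0" for x :: "real ^ 'n"
    using that by auto
  have Q: "norm x powr (p - 1) \<le> Q" if "norm x \<le> R" for x :: "real ^ 'n"
    using that p unfolding Q_def by (intro powr_mono2) auto
  have hx: "norm (h x) \<le> Q * H * norm x" if "norm x \<le> R" for x
  proof (cases "x = 0")
    case True
    then show ?thesis using homogeneous_zero[OF hom] p by simp
  next
    case False
    have "h x = norm x powr p *\<^sub>R h (x /\<^sub>R norm x)"
      using hom False unit(1)[OF False] unfolding homogeneous_def by (metis zero_less_norm_iff)
    then have "norm (h x) = norm x powr p * norm (h (x /\<^sub>R norm x))" by simp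
    also have "norm x powr p = norm x powr (p - 1) * norm x"
      using False by (simp add: powr_diff)
    also have "\<dots> * norm (h (x /\<^sub>R norm x)) \<le> (Q * norm x) * H"
      using Q[OF that] H[OF unit(2)[OF False]] H0
      by (intro mult_mono mult_right_mono) (auto simp: Q_def)
    finally show ?thesis by (simp add: mult_ac)
  qed
  have jac: "onorm (\<lambda>y. jacobian h (at x) *v y) \<le> K" if x: "x \<noteq> 0" "norm x \<le> R" for x
    unfolding K_def
  proof (rule onorm_le_matrix_component)
    fix i j
    have "jacobian h (at x) = (norm x powr (p - 1)) *\<^sub>R jacobian h (at (x /\<^sub>R norm x))"
      using homogeneous_jacobian[OF C1 hom, of "x /\<^sub>R norm x" "norm x"] x(1) unit(1)[OF x(1)] by simp
    then have "norm (jacobian h (at x)) = norm x powr (p - 1) * norm (jacobian h (at (x /\<^sub>R norm x)))"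
      by simp
    also have "\<dots> \<le> Q * J"
      using Q[OF x(2)] J[OF unit(2)[OF x(1)]] by (intro mult_mono) (auto simp: Q_def)
    finally show "\<bar>jacobian h (at x) $ i $ j\<bar> \<le> Q * J"
      using component_le_norm_cart[of "jacobian h (at x) $ i" j] Finite_Cartesian_Product.norm_nth_le[of "jacobian h (at x)" i]
      by linarith
  qed
  define L where "L = max K (Q * H)"
  have L0: "0 \<le> L" using H0 by (auto simp: L_def Q_def le_max_iff_disj)
  have "norm (h x - h y) \<le> L * norm (x - y)" if xy: "norm x \<le> R" "norm y \<le> R" for x y
  proof (cases "0 \<in> closed_segment x y")
    case True
    then have "norm (x - y) = norm x + norm y"
      by (simp add: between_mem_segment[symmetric] between dist_norm)
    have "norm (h x - h y) \<le> norm (h x) + norm (h y)" by (rule norm_triangle_ineq4)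
    also have "\<dots> \<le> Q * H * norm x + Q * H * norm y" using hx xy by (intro add_mono) auto
    also have "\<dots> = Q * H * norm (x - y)" unfolding \<open>norm (x - y) = _\<close> by (simp add: algebra_simps)
    also have "\<dots> \<le> L * norm (x - y)" by (intro mult_right_mono) (auto simp: L_def)
    finally show ?thesis .
  next
    case False
    have sub: "norm z \<le> R" if "z \<in> closed_segment x y" for z
      using that xy convex_cball[of 0 R] closed_segment_subset[of x "cball 0 R" y] by (auto simp: subset_iff)
    have "norm (h x - h y) \<le> K * norm (x - y)"
    proof (rule differentiable_bound[of "closed_segment x y" h "\<lambda>z y. jacobian h (at z) *v y"])
      fix z assume z: "z \<in> closed_segment x y"
      then have "z \<noteq> 0" using False by auto
      then show "(h has_derivative (\<lambda>y. jacobian h (at z) *v y)) (at z within closed_segment x y)"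
        "onorm (\<lambda>y. jacobian h (at z) *v y) \<le> K"
        using C1_has_derivative[OF C1] jac sub[OF z] has_derivative_at_withinI by blast+
    qed auto
    also have "\<dots> \<le> L * norm (x - y)" by (intro mult_right_mono) (auto simp: L_def)
    finally show ?thesis .
  qed
  then show ?thesis using L0 by blast
qed

text \<open>
  Kamke's condition, by the mean value theorem on the segment from \<open>x\<close> to \<open>u\<close>: along it only the
  off-diagonal derivatives enter. The open segment avoids the origin even when \<open>x = 0\<close>.
\<close>

lemma cooperative_mono:
  fixes f :: "real ^ 'n \<Rightarrow> real ^ 'n"
  assumes f: "cooperative f" and x: "0 \<le> x" "x \<le> u" "x $ i = u $ i"
  shows "f x $ i \<le> f u $ i"
proof (cases "x = u")
  case False
  define \<phi> where "\<phi> = (\<lambda>s. f (x + s *\<^sub>R (u - x)) $ i)"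
  have pt: "0 \<le> x + s *\<^sub>R (u - x)" "x + s *\<^sub>R (u - x) \<noteq> 0" if "0 < s" for s
  proof -
    show nn: "0 \<le> x + s *\<^sub>R (u - x)"
      unfolding less_eq_vec_def
    proof
      fix j
      have "0 \<le> x $ j" "0 \<le> s * (u $ j - x $ j)" using x that by (auto simp: less_eq_vec_def)
      then show "0 $ j \<le> (x + s *\<^sub>R (u - x)) $ j" by simp
    qed
    show "x + s *\<^sub>R (u - x) \<noteq> 0"
    proof
      assume "x + s *\<^sub>R (u - x) = 0"
      then have "(x + s *\<^sub>R (u - x)) $ j = 0" for j by simp
      then have "x $ j + s * (u $ j - x $ j) = 0" for j by simp
      moreover have "0 \<le> x $ j" "0 \<le> s * (u $ j - x $ j)" for j
        using x that by (auto simp: less_eq_vec_def)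
      ultimately have "x $ j = 0 \<and> s * (u $ j - x $ j) = 0" for j
        by (metis add_nonneg_eq_0_iff)
      then have "x $ j = u $ j" for j using that by (metis mult_eq_0_iff eq_iff_diff_eq_0 order_less_irrefl)
      then show False using False by (simp add: vec_eq_iff)
    qed
  qed
  define \<phi>' where "\<phi>' = (\<lambda>s d. (jacobian f (at (x + s *\<^sub>R (u - x))) *v (d *\<^sub>R (u - x))) $ i)"
  have "continuous_on UNIV f" using f by (simp add: cooperative_def)
  then have "continuous_on {0..1} (\<lambda>s. f (x + s *\<^sub>R (u - x)))"
    by (rule continuous_on_compose2) (auto intro!: continuous_intros)
  then have cont: "continuous_on {0..1} \<phi>"
    unfolding \<phi>_def by (rule continuous_on_component)
  have der: "(\<phi> has_derivative \<phi>' s) (at s)" if s: "0 < s" for s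
  proof -
    have "(f has_derivative (\<lambda>y. jacobian f (at (x + s *\<^sub>R (u - x))) *v y)) (at (x + s *\<^sub>R (u - x)))"
      by (rule C1_has_derivative) (use f pt[OF s] in \<open>auto simp: cooperative_def\<close>)
    moreover have "((\<lambda>s. x + s *\<^sub>R (u - x)) has_derivative (\<lambda>d. d *\<^sub>R (u - x))) (at s)"
      by (auto intro!: derivative_eq_intros)
    ultimately have "((\<lambda>s. f (x + s *\<^sub>R (u - x))) has_derivative
        (\<lambda>d. jacobian f (at (x + s *\<^sub>R (u - x))) *v (d *\<^sub>R (u - x)))) (at s)"
      using has_derivative_compose by blast
    then show ?thesis
      unfolding \<phi>_def \<phi>'_def by (rule bounded_linear.has_derivative[OF bounded_linear_vec_nth])
  qed
  obtain s where s: "0 < s" "s < 1" and eq: "\<phi> 1 - \<phi> 0 = \<phi>' s (1 - 0)"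
    using mvt[OF zero_less_one cont, of \<phi>'] der by blast
  have M: "metzler (jacobian f (at (x + s *\<^sub>R (u - x))))"
    using f pt[OF s(1)] by (auto simp: cooperative_def)
  have "0 \<le> (jacobian f (at (x + s *\<^sub>R (u - x))) *v (u - x)) $ i"
    unfolding matrix_vector_mult_def vec_lambda_beta
  proof (rule sum_nonneg)
    fix j
    show "0 \<le> jacobian f (at (x + s *\<^sub>R (u - x))) $ i $ j * (u - x) $ j"
      using M x by (cases "j = i") (auto simp: metzler_def less_eq_vec_def)
  qed
  then show ?thesis using eq by (simp add: \<phi>_def \<phi>'_def)
qed simp

section \<open>Cooperative systems with bounded delays\<close>

locale cooperative_delay_system =
  fixes \<alpha> v :: "real ^ 'n"
    and f :: "real ^ 'n \<Rightarrow> real ^ 'n"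
    and g :: "nat \<Rightarrow> real ^ 'n \<Rightarrow> real ^ 'n"
    and m :: nat
    and p r :: real
    and \<tau> :: "nat \<Rightarrow> real \<Rightarrow> real"
  assumes alpha: "\<And>i. 0 < \<alpha> $ i" "\<And>i. \<alpha> $ i \<le> 1"
    and r: "r \<ge> 0"
    and tau_cont: "\<And>j. j \<in> {1..m} \<Longrightarrow> continuous_on {0..} (\<tau> j)"
    and tau: "\<And>j t. j \<in> {1..m} \<Longrightarrow> t \<ge> 0 \<Longrightarrow> 0 \<le> \<tau> j t \<and> \<tau> j t \<le> r"
    and p: "p \<ge> 1"
    and coop: "cooperative f" and f_hom: "homogeneous p f"
    and g_cont: "\<And>j. j \<in> {1..m} \<Longrightarrow> continuous_on UNIV (g j)"
    and g_C1: "\<And>j. j \<in> {1..m} \<Longrightarrow> C1_away_from_0 (g j)"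
    and g_mono: "\<And>j. j \<in> {1..m} \<Longrightarrow> order_preserving (g j)"
    and g_hom: "\<And>j. j \<in> {1..m} \<Longrightarrow> homogeneous p (g j)"
    and v: "\<And>i. 0 < v $ i"
    and decay: "\<And>i. (f v + (\<Sum>j=1..m. g j v)) $ i < 0"
begin

definition rhs :: "(real \<Rightarrow> real ^ 'n) \<Rightarrow> real \<Rightarrow> real ^ 'n" where
  "rhs w t = f (w t) + (\<Sum>j=1..m. g j (w (t - \<tau> j t)))"

lemma f_cont: "continuous_on UNIV f" and f_C1: "C1_away_from_0 f"
  using coop by (auto simp: cooperative_def)

lemma f_0 [simp]: "f 0 = 0"
  using homogeneous_zero[OF f_hom] p by simp

lemma g_0: "j \<in> {1..m} \<Longrightarrow> g j 0 = 0"
  using homogeneous_zero[OF g_hom] p by simp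

lemma g_nonneg: "j \<in> {1..m} \<Longrightarrow> 0 \<le> x \<Longrightarrow> 0 \<le> g j x"
  using g_mono[of j] g_0[of j] unfolding order_preserving_def by (metis order_refl)

lemma f_nonneg:
  assumes "0 \<le> x" "x $ i = 0" shows "0 \<le> f x $ i"
  using cooperative_mono[OF coop, of 0 x i] assms by simp

lemma rhs_continuous:
  assumes w: "continuous_on {- r..b} w"
  shows "continuous_on {0..b} (rhs w)"
  unfolding rhs_def
proof (intro continuous_on_add continuous_on_sum)
  show "continuous_on {0..b} (\<lambda>t. f (w t))"
    by (rule continuous_on_compose2[OF f_cont]) (use r in \<open>auto intro: continuous_on_subset[OF w]\<close>)
  fix j assume j: "j \<in> {1..m}"
  have "continuous_on {0..b} (\<lambda>t. t - \<tau> j t)"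
    by (intro continuous_intros continuous_on_subset[OF tau_cont[OF j]]) auto
  then have "continuous_on {0..b} (\<lambda>t. w (t - \<tau> j t))"
    by (rule continuous_on_compose2[OF w]) (use tau[OF j] in \<open>force\<close>)
  then show "continuous_on {0..b} (\<lambda>t. g j (w (t - \<tau> j t)))"
    by (rule continuous_on_compose2[OF g_cont[OF j]]) auto
qed

lemma rhs_lipschitz:
  "\<exists>L>0. \<forall>w w' t c. 0 \<le> t \<longrightarrow> (\<forall>s\<in>{- r..t}. norm (w s) \<le> R \<and> norm (w' s) \<le> R \<and> norm (w s - w' s) \<le> c)
      \<longrightarrow> norm (rhs w t - rhs w' t) \<le> L * c"
proof -
  obtain Lf where Lf: "Lf \<ge> 0" "\<And>x y. norm x \<le> R \<Longrightarrow> norm y \<le> R \<Longrightarrow> norm (f x - f y) \<le> Lf * norm (x - y)"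
    using homogeneous_lipschitz[OF f_C1 f_cont f_hom p, of R] by blast
  have "\<forall>j\<in>{1..m}. \<exists>L\<ge>0. \<forall>x y. norm x \<le> R \<longrightarrow> norm y \<le> R \<longrightarrow> norm (g j x - g j y) \<le> L * norm (x - y)"
    using homogeneous_lipschitz[OF g_C1 g_cont g_hom p] by blast
  then obtain Lg where Lg: "\<forall>j\<in>{1..m}. 0 \<le> Lg j \<and>
      (\<forall>x y. norm x \<le> R \<longrightarrow> norm y \<le> R \<longrightarrow> norm (g j x - g j y) \<le> Lg j * norm (x - y))"
    by metis
  define L where "L = Lf + (\<Sum>j=1..m. Lg j) + 1"
  have "L > 0" unfolding L_def using Lf(1) Lg by (intro add_nonneg_pos add_nonneg_nonneg sum_nonneg) auto
  moreover have "norm (rhs w t - rhs w' t) \<le> L * c" if t: "0 \<le> t"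
    and w: "\<forall>s\<in>{- r..t}. norm (w s) \<le> R \<and> norm (w' s) \<le> R \<and> norm (w s - w' s) \<le> c" for w w' t c
  proof -
    have c: "c \<ge> 0" using w t r order_trans[OF norm_ge_zero, of "w t - w' t" c] by auto
    have "norm (f (w t) - f (w' t)) \<le> Lf * norm (w t - w' t)" by (rule Lf(2)) (use w t r in auto)
    also have "\<dots> \<le> Lf * c" using w t r Lf(1) by (intro mult_left_mono) auto
    finally have 1: "norm (f (w t) - f (w' t)) \<le> Lf * c" .
    have 2: "norm (g j (w (t - \<tau> j t)) - g j (w' (t - \<tau> j t))) \<le> Lg j * c" if j: "j \<in> {1..m}" for j
    proof -
      have s: "t - \<tau> j t \<in> {- r..t}" using tau[OF j t] t by auto
      have "norm (g j (w (t - \<tau> j t)) - g j (w' (t - \<tau> j t))) \<le> Lg j * norm (w (t - \<tau> j t) - w' (t - \<tau> j t))"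
        using Lg j w s by blast
      also have "\<dots> \<le> Lg j * c" using w s Lg j by (intro mult_left_mono) auto
      finally show ?thesis .
    qed
    have "rhs w t - rhs w' t = (f (w t) - f (w' t))
        + (\<Sum>j=1..m. g j (w (t - \<tau> j t)) - g j (w' (t - \<tau> j t)))"
      by (simp add: rhs_def sum_subtractf)
    then have "norm (rhs w t - rhs w' t) \<le> norm (f (w t) - f (w' t))
        + norm (\<Sum>j=1..m. g j (w (t - \<tau> j t)) - g j (w' (t - \<tau> j t)))"
      by (simp only: norm_triangle_ineq)
    also have "\<dots> \<le> Lf * c + (\<Sum>j=1..m. Lg j * c)"
      by (intro add_mono 1 sum_norm_le 2)
    also have "\<dots> \<le> L * c" using c by (simp add: L_def distrib_right flip: sum_distrib_right)
    finally show ?thesis .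
  qed
  ultimately show ?thesis by blast
qed

text \<open>
  No sign is known for the solutions compared here, which is why the Lipschitz bounds cover whole
  balls and not only their nonnegative parts.
\<close>

lemma is_solution_unique:
  assumes sol: "is_solution \<alpha> f m g \<tau> r \<phi> T w" "is_solution \<alpha> f m g \<tau> r \<phi> T' w'"
    and t: "- r \<le> t" "ereal t < T" "ereal t < T'"
  shows "w t = w' t"
proof (cases "t \<le> 0")
  case True
  then show ?thesis using sol t by (simp add: is_solution_def)
next
  case False
  then obtain b where b: "t < b" "ereal b < T" "ereal b < T'"
    using ereal_dense2[of "ereal t" "min T T'"] t by auto
  have vol: "continuous_on {- r..b} x \<and> (\<forall>s\<in>{- r..0}. x s = \<phi> s) \<and>
      (\<forall>s i. 0 \<le> s \<longrightarrow> s < b \<longrightarrow> x s $ i = \<phi> 0 $ i + frac_integral (\<alpha> $ i) (\<lambda>u. rhs x u $ i) s)"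
    if x: "is_solution \<alpha> f m g \<tau> r \<phi> U x" and U: "ereal b < U" for x U
  proof -
    have sub: "s \<le> b \<Longrightarrow> ereal s < U" for s
      using U by (meson ereal_less_eq(3) order_le_less_trans)
    have c: "continuous_on {- r..b} x"
      using x sub unfolding is_solution_def by (auto elim!: continuous_on_subset)
    have ini: "\<forall>s\<in>{- r..0}. x s = \<phi> s" using x by (simp add: is_solution_def)
    have "x s $ i = x 0 $ i + frac_integral (\<alpha> $ i) (\<lambda>u. rhs x u $ i) s" if s: "0 \<le> s" "s < b" for s i
    proof (rule caputo_imp_volterra[OF alpha _ _ _ s])
      show "continuous_on {0..b} (\<lambda>s. x s $ i)"
        by (intro continuous_on_component continuous_on_subset[OF c]) (use r in auto)
      show "continuous_on {0..b} (\<lambda>s. rhs x s $ i)"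
        by (intro continuous_on_component rhs_continuous c)
      show "has_caputo_derivative (\<alpha> $ i) (\<lambda>s. x s $ i) (rhs x u $ i) u" if "0 < u" "u < b" for u
        using x sub[of u] that unfolding is_solution_def rhs_def by auto
    qed
    then show ?thesis using c ini r by auto
  qed
  note W = vol[OF sol(1) b(2)] and W' = vol[OF sol(2) b(3)]
  have c: "continuous_on {- r..t} w" "continuous_on {- r..t} w'"
    using W W' b(1) by (auto elim!: continuous_on_subset)
  have "bounded (w ` {- r..t} \<union> w' ` {- r..t})"
    using c by (auto intro!: compact_imp_bounded compact_continuous_image)
  then obtain R where R: "\<forall>x\<in>w ` {- r..t} \<union> w' ` {- r..t}. norm x \<le> R"
    unfolding bounded_iff by blast
  obtain L where L: "\<And>w w' t c. 0 \<le> t \<Longrightarrow>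
      \<forall>s\<in>{- r..t}. norm (w s) \<le> R \<and> norm (w' s) \<le> R \<and> norm (w s - w' s) \<le> c
      \<Longrightarrow> norm (rhs w t - rhs w' t) \<le> L * c"
    using rhs_lipschitz[of R] by blast
  have cr: "continuous_on {0..t} (rhs w)" "continuous_on {0..t} (rhs w')"
    by (intro rhs_continuous c)+
  have "w t - w' t = 0"
  proof (rule volterra_unique[of \<alpha> t "\<lambda>s. w s - w' s" "\<lambda>s. rhs w s - rhs w' s" L])
    show "continuous_on {0..t} (\<lambda>s. w s - w' s)"
      by (intro continuous_intros continuous_on_subset[OF c(1)] continuous_on_subset[OF c(2)]) (use r in auto)
    show "continuous_on {0..t} (\<lambda>s. rhs w s - rhs w' s)" by (intro continuous_intros cr)
    show "(w s - w' s) $ i = frac_integral (\<alpha> $ i) (\<lambda>s. (rhs w s - rhs w' s) $ i) s"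
      if s: "0 \<le> s" "s \<le> t" for s i
    proof -
      have "frac_integral (\<alpha> $ i) (\<lambda>u. rhs w u $ i - rhs w' u $ i) s
          = frac_integral (\<alpha> $ i) (\<lambda>u. rhs w u $ i) s - frac_integral (\<alpha> $ i) (\<lambda>u. rhs w' u $ i) s"
        by (intro frac_integral_diff_continuous less_imp_le[OF alpha(1)] s continuous_on_component
            continuous_on_subset[OF cr(1)] continuous_on_subset[OF cr(2)]) (use s in auto)
      then show ?thesis using W W' s b(1) by simp
    qed
    show "norm (rhs w s - rhs w' s) \<le> L * c" if s: "0 \<le> s" "s \<le> t" "0 \<le> c"
      and le: "\<And>u. 0 \<le> u \<Longrightarrow> u \<le> s \<Longrightarrow> norm (w u - w' u) \<le> c" for s c
    proof (rule L[OF s(1)], intro ballI conjI)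
      fix u assume u: "u \<in> {- r..s}"
      show "norm (w u) \<le> R" "norm (w' u) \<le> R" using R u s by auto
      show "norm (w u - w' u) \<le> c"
        using le[of u] u s W W' by (cases "u \<ge> 0") auto
    qed
  qed (use alpha False in auto)
  then show ?thesis by simp
qed

text \<open>
  Caputo derivatives of powers \<open>(A + t) powr (- \<gamma>)\<close> have size \<open>t powr (- \<alpha>\<^sub>i)\<close>, while a vector field
  of degree \<open>p\<close> has size \<open>(A + t) powr (- \<gamma> * p)\<close> along them. The exponent is small enough for the
  latter to dominate in every component.
\<close>

definition \<gamma> :: real where
  "\<gamma> = Min (range (\<lambda>i. \<alpha> $ i)) / (2 * p)"

lemma \<gamma>_pos: "\<gamma> > 0"
proof -
  have "Min (range (\<lambda>i. \<alpha> $ i)) > 0" using alpha(1) by (subst Min_gr_iff) auto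
  then show ?thesis using p by (simp add: \<gamma>_def)
qed

lemma \<gamma>_less: "\<gamma> * p < \<alpha> $ i"
proof -
  have "Min (range (\<lambda>i. \<alpha> $ i)) \<le> \<alpha> $ i" by (rule Min_le) auto
  moreover have "\<gamma> * p = Min (range (\<lambda>i. \<alpha> $ i)) / 2" using p by (simp add: \<gamma>_def)
  moreover have "\<gamma> * p > 0" using \<gamma>_pos p by simp
  ultimately show ?thesis by linarith
qed

lemma \<gamma>_less_1: "\<gamma> < 1"
proof -
  have "\<gamma> * 1 \<le> \<gamma> * p" using \<gamma>_pos p by (intro mult_left_mono) auto
  also have "\<dots> < 1" using \<gamma>_less alpha(2) order_less_le_trans by blast
  finally show ?thesis by simp
qed

definition barrier :: "real \<Rightarrow> real \<Rightarrow> real \<Rightarrow> real ^ 'n" where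
  "barrier K A t = (K * (A + t) powr (- \<gamma>)) *\<^sub>R v"

definition barrier_caputo :: "real \<Rightarrow> real \<Rightarrow> 'n \<Rightarrow> real \<Rightarrow> real" where
  "barrier_caputo K A i t =
     (K * v $ i) * (- \<gamma> * frac_integral (1 - \<alpha> $ i) (\<lambda>u. (A + u) powr (- \<gamma> - 1)) t)"

lemma barrier_volterra:
  assumes "A > 0" "t \<ge> 0"
  shows "barrier K A t $ i = barrier K A 0 $ i + frac_integral (\<alpha> $ i) (barrier_caputo K A i) t"
proof -
  have "barrier K A t $ i = (K * v $ i) * (A + t) powr (- \<gamma>)" by (simp add: barrier_def)
  also have "\<dots> = (K * v $ i) * A powr (- \<gamma>) + (K * v $ i) * frac_integral (\<alpha> $ i)
      (\<lambda>s. - \<gamma> * frac_integral (1 - \<alpha> $ i) (\<lambda>u. (A + u) powr (- \<gamma> - 1)) s) t"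
    by (subst shifted_power_volterra[OF assms(1) alpha assms(2)]) (rule distrib_left)
  also have "(K * v $ i) * frac_integral (\<alpha> $ i)
      (\<lambda>s. - \<gamma> * frac_integral (1 - \<alpha> $ i) (\<lambda>u. (A + u) powr (- \<gamma> - 1)) s) t
      = frac_integral (\<alpha> $ i) (barrier_caputo K A i) t"
    unfolding barrier_caputo_def by (rule frac_integral_cmult[symmetric])
  finally show ?thesis by (simp add: barrier_def)
qed

lemma barrier_caputo_continuous:
  assumes "A > 0" shows "continuous_on {0..} (barrier_caputo K A i)"
proof -
  have "continuous_on {0..T} (\<lambda>u. (A + u) powr (- \<gamma> - 1))" for T
    by (intro continuous_intros) (use assms in auto)
  then have "continuous_on {0..T} (barrier_caputo K A i)" for T
    unfolding barrier_caputo_def using alpha(2)[of i]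
    by (intro continuous_on_mult_left continuous_on_frac_integral) auto
  then show ?thesis by (rule continuous_on_atLeast_if_Icc)
qed

text \<open>
  As \<open>A\<close> grows, a bounded delay changes the barrier by a factor tending to \<open>1\<close>, so by homogeneity
  the right-hand side along the barrier tends to \<open>f v + (\<Sum>j. g j v)\<close> times its \<open>p\<close>-th power,
  a negative multiple, while its Caputo derivative becomes negligible in comparison. Since
  \<open>p \<ge> 1\<close>, scaling up by \<open>K \<ge> 1\<close> only helps.
\<close>

lemma barrier_supersolution:
  "\<exists>A>r. A \<ge> 1 \<and> (\<forall>K\<ge>1. \<forall>t\<ge>0. \<forall>i. rhs (barrier K A) t $ i < barrier_caputo K A i t)"
proof -
  define G where "G = (\<lambda>i. \<Sum>j=1..m. g j v $ i)"
  have v0: "0 \<le> v" using v by (simp add: less_eq_vec_def less_imp_le)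
  have fG: "f v $ i + G i < 0" for i using decay[of i] by (simp add: G_def)
  have "\<forall>i. \<exists>C>0. \<forall>A>0. \<forall>t\<ge>0. frac_integral (1 - \<alpha> $ i) (\<lambda>u. (A + u) powr (- \<gamma> - 1)) t
            \<le> C * A powr (- (\<gamma> + \<alpha> $ i - \<gamma> * p)) * (A + t) powr (- (\<gamma> * p))"
    using shifted_power_bound[OF alpha _ \<gamma>_less \<gamma>_pos] \<gamma>_pos p by simp
  then obtain C where C: "\<And>i A t. A > 0 \<Longrightarrow> t \<ge> 0 \<Longrightarrow>
      frac_integral (1 - \<alpha> $ i) (\<lambda>u. (A + u) powr (- \<gamma> - 1)) t
      \<le> C i * A powr (- (\<gamma> + \<alpha> $ i - \<gamma> * p)) * (A + t) powr (- (\<gamma> * p))"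
    by metis
  define h where "h = (\<lambda>A i. f v $ i + (1 - r / A) powr (- (\<gamma> * p)) * G i
      + v $ i * \<gamma> * (C i * A powr (- (\<gamma> + \<alpha> $ i - \<gamma> * p))))"
  have "((\<lambda>A. h A i) \<longlongrightarrow> f v $ i + (1 - 0) powr (- (\<gamma> * p)) * G i + v $ i * \<gamma> * (C i * 0)) at_top" for i
    unfolding h_def
    by (intro tendsto_intros tendsto_neg_powr tendsto_divide_0[OF tendsto_const] filterlim_at_top_imp_at_infinity
        filterlim_ident) (use \<gamma>_less[of i] \<gamma>_pos in auto)
  then have "\<forall>\<^sub>F A in at_top. h A i < 0" for i
    by (rule order_tendstoD) (use fG in simp)
  then have "\<forall>\<^sub>F A in at_top. \<forall>i. h A i < 0" by (rule eventually_all_finite)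
  then have "\<forall>\<^sub>F A in at_top. A > r \<and> A \<ge> 1 \<and> (\<forall>i. h A i < 0)"
    using eventually_gt_at_top[of r] eventually_ge_at_top[of 1] by eventually_elim simp
  then obtain A where A: "A > r" "A \<ge> 1" "\<And>i. h A i < 0"
    by (auto dest!: eventually_happens)
  have "rhs (barrier K A) t $ i < barrier_caputo K A i t" if K: "K \<ge> 1" and t: "t \<ge> 0" for K t i
  proof -
    define z where "z = (A + t) powr (- (\<gamma> * p))"
    have z: "z > 0" using A t by (simp add: z_def)
    have Kp: "K powr p \<ge> K" using powr_mono[OF p K] K by simp
    have pw: "(K * (A + s) powr (- \<gamma>)) powr p = K powr p * (A + s) powr (- (\<gamma> * p))" if "s > - A" for s
      using K by (simp add: powr_mult powr_powr)
    have hom: "h' (barrier K A s) = (K powr p * (A + s) powr (- (\<gamma> * p))) *\<^sub>R h' v"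
      if "homogeneous p h'" "s > - A" for h' :: "real ^ 'n \<Rightarrow> real ^ 'n" and s
    proof -
      have "K * (A + s) powr (- \<gamma>) > 0" using K that by simp
      then show ?thesis
        using that(1) pw[OF that(2)] unfolding homogeneous_def barrier_def by simp
    qed
    have gj: "g j (barrier K A (t - \<tau> j t)) $ i \<le> K powr p * (z * (1 - r / A) powr (- (\<gamma> * p))) * g j v $ i"
      if j: "j \<in> {1..m}" for j
    proof -
      have "(A + t) * (1 - r / A) \<le> A + (t - \<tau> j t)"
      proof -
        define q where "q = r * (A + t) / A"
        have "r \<le> q" unfolding q_def using A t r by (simp add: field_simps)
        moreover have "(A + t) * (1 - r / A) = A + t - q" by (simp add: q_def field_simps)
        ultimately show ?thesis using tau[OF j t] by linarith
      qed
      moreover have "(A + t) * (1 - r / A) > 0" using A t r by (intro mult_pos_pos) auto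
      ultimately have "(A + (t - \<tau> j t)) powr (- (\<gamma> * p)) \<le> ((A + t) * (1 - r / A)) powr (- (\<gamma> * p))"
        using \<gamma>_pos p by (intro powr_mono2') auto
      also have "\<dots> = z * (1 - r / A) powr (- (\<gamma> * p))"
        using A t r by (simp add: z_def powr_mult)
      finally have le: "(A + (t - \<tau> j t)) powr (- (\<gamma> * p)) \<le> z * (1 - r / A) powr (- (\<gamma> * p))" .
      have "0 \<le> g j v $ i" using g_nonneg[OF j v0] by (simp add: less_eq_vec_def)
      moreover have "t - \<tau> j t > - A" using tau[OF j t] t A by auto
      ultimately show ?thesis
        using le by (simp only: hom[OF g_hom[OF j]] vector_scaleR_component real_scaleR_def)
          (intro mult_right_mono mult_left_mono, auto)
    qed
    have "rhs (barrier K A) t $ i = K powr p * z * f v $ i + (\<Sum>j=1..m. g j (barrier K A (t - \<tau> j t)) $ i)"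
      using hom[OF f_hom, of t] A t r by (simp add: rhs_def z_def)
    also have "\<dots> \<le> K powr p * z * f v $ i
        + (\<Sum>j=1..m. K powr p * (z * (1 - r / A) powr (- (\<gamma> * p))) * g j v $ i)"
      by (intro add_left_mono sum_mono gj)
    also have "\<dots> = K powr p * z * (f v $ i + (1 - r / A) powr (- (\<gamma> * p)) * G i)"
      unfolding G_def distrib_left sum_distrib_left by (simp add: mult_ac)
    also have "\<dots> \<le> K * z * (f v $ i + (1 - r / A) powr (- (\<gamma> * p)) * G i)"
    proof (rule mult_right_mono_neg)
      show "K * z \<le> K powr p * z" using Kp z by (intro mult_right_mono) auto
      have "0 \<le> frac_integral (1 - \<alpha> $ i) (\<lambda>u. (A + u) powr (- \<gamma> - 1)) t"
      proof (cases "\<alpha> $ i = 1")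
        case False
        then have a1: "1 - \<alpha> $ i > 0" using alpha(2)[of i] by simp
        have "frac_integral (1 - \<alpha> $ i) (\<lambda>u. 0) t \<le> frac_integral (1 - \<alpha> $ i) (\<lambda>u. (A + u) powr (- \<gamma> - 1)) t"
          by (rule frac_integral_mono[OF a1])
             (use A t a1 in \<open>auto intro!: frac_integrable_continuous continuous_intros\<close>)
        then show ?thesis using frac_integral_const[OF a1 t, of 0] by simp
      qed simp
      also have "\<dots> \<le> C i * A powr (- (\<gamma> + \<alpha> $ i - \<gamma> * p)) * z"
        unfolding z_def by (rule C) (use A t in auto)
      finally have "0 \<le> C i * A powr (- (\<gamma> + \<alpha> $ i - \<gamma> * p))"
        using z by (simp add: zero_le_mult_iff)
      then have "0 \<le> v $ i * \<gamma> * (C i * A powr (- (\<gamma> + \<alpha> $ i - \<gamma> * p)))"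
        using v[of i] \<gamma>_pos by (intro mult_nonneg_nonneg[of "v $ i * \<gamma>"]) simp_all
      then show "f v $ i + (1 - r / A) powr (- (\<gamma> * p)) * G i \<le> 0"
        using A(3)[of i] unfolding h_def by linarith
    qed
    also have "\<dots> < K * z * (- (v $ i * \<gamma> * (C i * A powr (- (\<gamma> + \<alpha> $ i - \<gamma> * p)))))"
    proof (rule mult_strict_left_mono)
      show "f v $ i + (1 - r / A) powr (- (\<gamma> * p)) * G i < - (v $ i * \<gamma> * (C i * A powr (- (\<gamma> + \<alpha> $ i - \<gamma> * p))))"
        using A(3)[of i] unfolding h_def by linarith
    qed (use K z in simp)
    also have "\<dots> = - (K * v $ i * \<gamma>) * (C i * A powr (- (\<gamma> + \<alpha> $ i - \<gamma> * p)) * z)"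
      by (simp add: mult_ac)
    also have "\<dots> \<le> - (K * v $ i * \<gamma>) * frac_integral (1 - \<alpha> $ i) (\<lambda>u. (A + u) powr (- \<gamma> - 1)) t"
      unfolding z_def using A t K v[of i] \<gamma>_pos
      by (intro mult_left_mono_neg C) (auto intro!: mult_nonneg_nonneg)
    finally show ?thesis by (simp add: barrier_caputo_def)
  qed
  then show ?thesis using A by blast
qed

text \<open>
  The state is clamped to the box between \<open>0\<close> and the barrier, which makes the right-hand side
  globally Lipschitz and bounded. The clamped solution cannot leave the box: at a face of it the
  clamped coordinate sits exactly on that face while the others stay in the box, so Kamke's
  condition and monotonicity of the delayed terms give the sign of the Caputo derivative there.
  Hence the clamping is never active.
\<close>

lemma solution_exists:
  assumes \<phi>: "continuous_on {- r..0} \<phi>" "\<And>s. s \<in> {- r..0} \<Longrightarrow> 0 \<le> \<phi> s"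
  shows "\<exists>w A K. A \<ge> 1 \<and> K > 0 \<and> is_solution \<alpha> f m g \<tau> r \<phi> \<infinity> w \<and>
           (\<forall>t\<ge>0. 0 \<le> w t \<and> w t \<le> barrier K A t)"
proof -
  obtain A where A: "A > r" "A \<ge> 1"
    and super: "\<And>K t i. K \<ge> 1 \<Longrightarrow> t \<ge> 0 \<Longrightarrow> rhs (barrier K A) t $ i < barrier_caputo K A i t"
    using barrier_supersolution by blast
  obtain M where M: "M \<ge> 0" "\<And>s. s \<in> {- r..0} \<Longrightarrow> norm (\<phi> s) \<le> M"
  proof -
    have "bounded (\<phi> ` {- r..0})"
      using \<phi>(1) by (intro compact_imp_bounded compact_continuous_image) auto
    then obtain M where M: "\<forall>x\<in>\<phi> ` {- r..0}. norm x \<le> M" unfolding bounded_iff by blast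
    then have "norm (\<phi> 0) \<le> M" using r by auto
    then show ?thesis using that[of M] M order_trans[OF norm_ge_zero] by blast
  qed
  (* On {-r..0} the barrier is smallest at 0; this K makes it dominate the initial function. *)
  define K where "K = 1 + (\<Sum>i\<in>UNIV. M / (A powr (- \<gamma>) * v $ i))"
  have term_nonneg: "0 \<le> M / (A powr (- \<gamma>) * v $ i)" for i
    using M(1) v[of i] by (intro divide_nonneg_nonneg mult_nonneg_nonneg) auto
  have K: "K \<ge> 1" unfolding K_def using term_nonneg by (simp add: sum_nonneg)
  define u where "u = barrier K A"
  have u_nonneg: "0 \<le> u s" for s
    using K v by (simp add: u_def barrier_def less_eq_vec_def less_imp_le)
  have u_cont: "continuous_on {- r..b} u" for b
    unfolding u_def barrier_def by (intro continuous_intros) (use A in auto)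
  have u_anti: "u s $ i \<le> u (- r) $ i" if "- r \<le> s" for s i
  proof -
    have "(A + s) powr (- \<gamma>) \<le> (A + - r) powr (- \<gamma>)"
      using that A \<gamma>_pos by (intro powr_mono2') auto
    then show ?thesis using K v[of i] unfolding u_def barrier_def
      by (simp add: mult_right_mono mult_left_mono less_imp_le)
  qed
  have \<phi>_le: "\<phi> s \<le> u s" if s: "s \<in> {- r..0}" for s
    unfolding less_eq_vec_def
  proof
    fix i
    have "\<phi> s $ i \<le> M" using component_le_norm_cart[of "\<phi> s" i] M(2)[OF s] by simp
    also have "M = M / (A powr (- \<gamma>) * v $ i) * (A powr (- \<gamma>) * v $ i)"
      using A v[of i] by simp
    also have "\<dots> \<le> K * (A powr (- \<gamma>) * v $ i)"
    proof (rule mult_right_mono)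
      have "M / (A powr (- \<gamma>) * v $ i) \<le> (\<Sum>i\<in>UNIV. M / (A powr (- \<gamma>) * v $ i))"
        by (rule member_le_sum) (use term_nonneg in auto)
      then show "M / (A powr (- \<gamma>) * v $ i) \<le> K" by (simp add: K_def)
    qed (use v[of i] in simp)
    also have "\<dots> \<le> K * ((A + s) powr (- \<gamma>) * v $ i)"
      using K s A v[of i] \<gamma>_pos by (intro mult_left_mono mult_right_mono powr_mono2') auto
    finally show "\<phi> s $ i \<le> u s $ i" by (simp add: u_def barrier_def mult.assoc)
  qed
  define P where "P = (\<lambda>s x. \<chi> i. max 0 (min (u s $ i) (x $ i)))"
  have P_box: "0 \<le> P s x" "P s x \<le> u s" for s x
    using u_nonneg[of s] by (auto simp: P_def less_eq_vec_def)
  have P_id: "P s x = x" if "0 \<le> x" "x \<le> u s" for s x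
    using that by (simp add: P_def less_eq_vec_def vec_eq_iff)
  have P_lip: "norm (P s x - P s y) \<le> norm (x - y)" for s x y
    by (rule norm_le_componentwise_cart) (auto simp: P_def)
  have P_cont: "continuous_on {- r..b} (\<lambda>s. P s (w s))" if "continuous_on {- r..b} w" for w b
    unfolding P_def by (intro continuous_intros u_cont that)
  define R where "R = norm (u (- r))"
  have P_bdd: "norm (P s x) \<le> R" if "- r \<le> s" for s x
    unfolding R_def
  proof (rule norm_le_componentwise_cart)
    fix i
    show "norm (P s x $ i) \<le> norm (u (- r) $ i)"
      using P_box[of s x] u_anti[OF that, of i] by (auto simp: less_eq_vec_def dest!: spec[of _ i])
  qed
  define N where "N = (\<lambda>w. rhs (\<lambda>s. P s (w s)))"
  obtain L where L: "L > 0" "\<And>w w' t c. 0 \<le> t \<Longrightarrow>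
      \<forall>s\<in>{- r..t}. norm (w s) \<le> R \<and> norm (w' s) \<le> R \<and> norm (w s - w' s) \<le> c
      \<Longrightarrow> norm (rhs w t - rhs w' t) \<le> L * c"
    using rhs_lipschitz[of R] by blast
  have rhs_0: "rhs (\<lambda>s. 0) t = 0" for t using g_0 by (simp add: rhs_def)
  have N_cont: "continuous_on {0..} (N w)" if "continuous_on UNIV w" for w
    unfolding N_def
    by (intro continuous_on_atLeast_if_Icc rhs_continuous P_cont continuous_on_subset[OF that]) auto
  define \<phi>' where "\<phi>' = (\<lambda>s. \<phi> (max (- r) (min 0 s)))"
  have "\<exists>w. continuous_on UNIV w \<and> (\<forall>t\<le>0. w t = \<phi>' t) \<and>
    (\<forall>t\<ge>0. \<forall>i. w t $ i = \<phi>' 0 $ i + frac_integral (\<alpha> $ i) (\<lambda>s. N w s $ i) t)"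
  proof (rule volterra_exists[OF alpha(1) _ L(1) N_cont])
    show "continuous_on UNIV \<phi>'"
      unfolding \<phi>'_def
      by (rule continuous_on_compose2[OF \<phi>(1)]) (use r in \<open>auto intro!: continuous_intros\<close>)
    show "norm (N w t) \<le> L * R" if t: "t \<ge> 0" for w t
    proof -
      have "norm (rhs (\<lambda>s. P s (w s)) t - rhs (\<lambda>s. 0) t) \<le> L * R"
        by (rule L(2)[OF t]) (use P_bdd in \<open>auto simp: R_def\<close>)
      then show ?thesis by (simp add: rhs_0 N_def)
    qed
    show "norm (N w t - N w' t) \<le> L * c"
      if t: "t \<ge> 0" and c: "\<And>s. s \<le> t \<Longrightarrow> norm (w s - w' s) \<le> c" for w w' t c
      unfolding N_def
    proof (rule L(2)[OF t], intro ballI conjI)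
      fix s assume s: "s \<in> {- r..t}"
      show "norm (P s (w s)) \<le> R" "norm (P s (w' s)) \<le> R" using s by (auto intro: P_bdd)
      show "norm (P s (w s) - P s (w' s)) \<le> c"
        using order_trans[OF P_lip c] s by simp
    qed
  qed
  then obtain w where w_cont: "continuous_on UNIV w" and w_init: "\<And>t. t \<le> 0 \<Longrightarrow> w t = \<phi>' t"
    and w: "\<And>t i. t \<ge> 0 \<Longrightarrow> w t $ i = \<phi>' 0 $ i + frac_integral (\<alpha> $ i) (\<lambda>s. N w s $ i) t"
    by blast
  have w_\<phi>: "w s = \<phi> s" if "s \<in> {- r..0}" for s
    using that w_init[of s] by (simp add: \<phi>'_def)
  have \<phi>'0: "\<phi>' 0 = \<phi> 0" using r by (simp add: \<phi>'_def)
  have zero: "0 \<in> {- r..0}" using r by simp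
  have Ni_cont: "continuous_on {0..} (\<lambda>s. N w s $ i)" for i
    by (intro continuous_on_component N_cont w_cont)
  have lower: "w t $ i \<ge> 0" if t: "t \<ge> 0" for t i
  proof (rule frac_nonneg[OF alpha Ni_cont w _ _ t])
    show "0 \<le> \<phi>' 0 $ i" using \<phi>(2)[OF zero] unfolding \<phi>'0 by (simp add: less_eq_vec_def)
    fix s :: real assume s: "0 \<le> s" "w s $ i < 0"
    have "P s (w s) $ i = 0" using s(2) by (simp add: P_def)
    then have "0 \<le> f (P s (w s)) $ i" by (intro f_nonneg P_box)
    moreover have "0 \<le> g j (P (s - \<tau> j s) (w (s - \<tau> j s))) $ i" if "j \<in> {1..m}" for j
      using g_nonneg[OF that P_box(1)] by (simp add: less_eq_vec_def)
    ultimately show "0 \<le> N w s $ i"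
      by (auto simp: N_def rhs_def intro!: add_nonneg_nonneg sum_nonneg)
  qed
  have upper: "u t $ i - w t $ i \<ge> 0" if t: "t \<ge> 0" for t i
  proof (rule frac_comparison[OF alpha _ _ _ _ t])
    have bc: "continuous_on {0..} (barrier_caputo K A i)"
      by (rule barrier_caputo_continuous) (use A in simp)
    show "continuous_on {0..} (\<lambda>s. barrier_caputo K A i s - N w s $ i)"
      by (intro continuous_intros bc Ni_cont)
    show "u s $ i - w s $ i = (u 0 $ i - \<phi>' 0 $ i)
        + frac_integral (\<alpha> $ i) (\<lambda>s. barrier_caputo K A i s - N w s $ i) s" if s: "0 \<le> s" for s
    proof -
      have "frac_integral (\<alpha> $ i) (\<lambda>s. barrier_caputo K A i s - N w s $ i) s
          = frac_integral (\<alpha> $ i) (barrier_caputo K A i) s - frac_integral (\<alpha> $ i) (\<lambda>s. N w s $ i) s"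
        by (intro frac_integral_diff_continuous less_imp_le[OF alpha(1)] s continuous_on_subset[OF bc]
            continuous_on_subset[OF Ni_cont]) auto
      then show ?thesis using w[OF s, of i] barrier_volterra[of A s K i] A s by (simp add: u_def)
    qed
    show "0 \<le> u 0 $ i - \<phi>' 0 $ i" using \<phi>_le[OF zero] unfolding \<phi>'0 by (simp add: less_eq_vec_def)
    fix s :: real assume s: "0 \<le> s" "u s $ i - w s $ i = 0"
    have "0 \<le> u s $ i" using u_nonneg[of s] by (simp add: less_eq_vec_def)
    then have "P s (w s) $ i = u s $ i" using s(2) by (simp add: P_def)
    then have "f (P s (w s)) $ i \<le> f (u s) $ i" by (intro cooperative_mono[OF coop] P_box)
    moreover have "g j (P (s - \<tau> j s) (w (s - \<tau> j s))) $ i \<le> g j (u (s - \<tau> j s)) $ i" if "j \<in> {1..m}" for j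
    proof -
      have "g j (P (s - \<tau> j s) (w (s - \<tau> j s))) \<le> g j (u (s - \<tau> j s))"
        using g_mono[OF that] P_box u_nonneg unfolding order_preserving_def by blast
      then show ?thesis by (simp add: less_eq_vec_def)
    qed
    ultimately have "N w s $ i \<le> rhs u s $ i"
      by (auto simp: N_def rhs_def intro!: add_mono sum_mono)
    also have "\<dots> < barrier_caputo K A i s" unfolding u_def by (rule super[OF K s(1)])
    finally show "0 < barrier_caputo K A i s - N w s $ i" by simp
  qed
  have box: "0 \<le> w s \<and> w s \<le> u s" if "- r \<le> s" for s
  proof (cases "s \<ge> 0")
    case True
    then show ?thesis using lower upper by (simp add: less_eq_vec_def)
  next
    case False
    then have "s \<in> {- r..0}" using that by simp
    then show ?thesis using \<phi>(2) \<phi>_le w_\<phi> by simp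
  qed
  have N_rhs: "N w t = rhs w t" if "t \<ge> 0" for t
  proof -
    have "- r \<le> t - \<tau> j t" if "j \<in> {1..m}" for j using tau[OF that \<open>t \<ge> 0\<close>] \<open>t \<ge> 0\<close> by simp
    then show ?thesis using that r unfolding N_def rhs_def
      by (intro arg_cong2[where f = "(+)"] sum.cong arg_cong[where f = f] arg_cong[where f = "g _"] P_id)
        (auto simp: box)
  qed
  have "is_solution \<alpha> f m g \<tau> r \<phi> \<infinity> w"
    unfolding is_solution_def
  proof (intro conjI ballI allI impI)
    show "continuous_on {t. - r \<le> t \<and> ereal t < \<infinity>} w" by (rule continuous_on_subset[OF w_cont]) simp
    fix t :: real and i assume t: "0 < t"
    have "has_caputo_derivative (\<alpha> $ i) (\<lambda>s. w s $ i) (N w t $ i) t"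
    proof (rule volterra_imp_caputo[OF alpha, of "t + 1"])
      show "w s $ i = w 0 $ i + frac_integral (\<alpha> $ i) (\<lambda>s. N w s $ i) s" if "0 \<le> s" for s
        using w[OF that, of i] w_\<phi>[OF zero] \<phi>'0 by simp
    qed (use t in \<open>auto intro: continuous_on_subset[OF Ni_cont]\<close>)
    then show "has_caputo_derivative (\<alpha> $ i) (\<lambda>s. w s $ i)
        ((f (w t) + (\<Sum>j=1..m. g j (w (t - \<tau> j t)))) $ i) t"
      using N_rhs[of t] t by (simp add: rhs_def)
  qed (use w_\<phi> in auto)
  then show ?thesis
    using A(2) K box r unfolding u_def by (intro exI[of _ w] exI[of _ A] exI[of _ K]) auto
qed

text \<open>The Mittag-Leffler function enters only through its power-law lower bound.\<close>

lemma mittag_leffler_stable: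
  assumes \<phi>: "continuous_on {- r..0} \<phi>" "\<And>s. s \<in> {- r..0} \<Longrightarrow> 0 \<le> \<phi> s"
  shows "\<exists>w. is_maximal_solution \<alpha> f m g \<tau> r \<phi> \<infinity> w \<and>
    (\<exists>c>0. \<exists>\<nu>>0. \<forall>t\<ge>0. norm (w t) \<le> \<nu> * mittag_leffler \<gamma> (- c * t powr \<gamma>))"
proof -
  obtain w A K where A: "A \<ge> 1" and K: "K > 0" and sol: "is_solution \<alpha> f m g \<tau> r \<phi> \<infinity> w"
    and box: "\<And>t. t \<ge> 0 \<Longrightarrow> 0 \<le> w t \<and> w t \<le> barrier K A t"
    using solution_exists[OF \<phi>] by blast
  have max: "is_maximal_solution \<alpha> f m g \<tau> r \<phi> \<infinity> w"
    unfolding is_maximal_solution_def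
  proof (intro conjI allI impI sol)
    fix T' w' t assume "is_solution \<alpha> f m g \<tau> r \<phi> T' w'" "- r \<le> t \<and> ereal t < T'"
    then show "w' t = w t" by (intro is_solution_unique[OF _ sol]) auto
  qed simp
  obtain c where c: "c > 0" "\<And>t. t \<ge> 0 \<Longrightarrow> (1 + t) powr (- \<gamma>) / 4 \<le> mittag_leffler \<gamma> (- c * t powr \<gamma>)"
    using mittag_leffler_lower_bound[OF \<gamma>_pos \<gamma>_less_1] by blast
  have v: "norm v > 0" using v by (metis less_irrefl zero_index zero_less_norm_iff)
  have "norm (w t) \<le> (4 * K * norm v) * mittag_leffler \<gamma> (- c * t powr \<gamma>)" if t: "t \<ge> 0" for t
  proof -
    have "norm (w t) \<le> norm (barrier K A t)"
    proof (rule norm_le_componentwise_cart)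
      fix i
      have "0 \<le> w t $ i" "w t $ i \<le> barrier K A t $ i" using box[OF t] by (simp_all add: less_eq_vec_def)
      then show "norm (w t $ i) \<le> norm (barrier K A t $ i)" by simp
    qed
    also have "\<dots> = K * norm v * (A + t) powr (- \<gamma>)" using K by (simp add: barrier_def)
    also have "\<dots> \<le> K * norm v * (1 + t) powr (- \<gamma>)"
      using K A t \<gamma>_pos by (intro mult_left_mono powr_mono2') auto
    also have "\<dots> = (4 * K * norm v) * ((1 + t) powr (- \<gamma>) / 4)" by simp
    also have "\<dots> \<le> (4 * K * norm v) * mittag_leffler \<gamma> (- c * t powr \<gamma>)"
      using K c(2)[OF t] by (intro mult_left_mono) auto
    finally show ?thesis .
  qed
  moreover have "4 * K * norm v > 0" using K v by simp
  ultimately show ?thesis using max c(1) by blast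
qed

end

theorem mainTheorem2:
  fixes \<alpha> v :: "real ^ 'n"
    and f :: "real ^ 'n \<Rightarrow> real ^ 'n"
    and g :: "nat \<Rightarrow> real ^ 'n \<Rightarrow> real ^ 'n"
    and m :: nat
    and p r :: real
    and rd :: "nat \<Rightarrow> real"
    and \<tau> :: "nat \<Rightarrow> real \<Rightarrow> real"
  assumes "m \<ge> 1"
    and "\<And>i. 0 < \<alpha> $ i \<and> \<alpha> $ i \<le> 1"
    and "\<And>j. j \<in> {1..m} \<Longrightarrow> rd j > 0"
    and "r = Max (rd ` {1..m})"
    and "\<And>j. j \<in> {1..m} \<Longrightarrow> continuous_on {0..} (\<tau> j)"
    and "\<And>j t. j \<in> {1..m} \<Longrightarrow> t \<ge> 0 \<Longrightarrow> \<tau> j t \<in> {0..rd j}"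
    and "p \<ge> 1"
    and "cooperative f"
    and "homogeneous p f"
    and "\<And>j. j \<in> {1..m} \<Longrightarrow> continuous_on UNIV (g j)"
    and "\<And>j. j \<in> {1..m} \<Longrightarrow> C1_away_from_0 (g j)"
    and "\<And>j. j \<in> {1..m} \<Longrightarrow> order_preserving (g j)"
    and "\<And>j. j \<in> {1..m} \<Longrightarrow> homogeneous p (g j)"
    and "0 \<prec> v"
    and "f v + (\<Sum>j=1..m. g j v) \<prec> 0"
  shows "\<exists>\<beta>>0. \<forall>\<phi> :: real \<Rightarrow> real ^ 'n.
           continuous_on {- r..0} \<phi> \<and> (\<forall>s\<in>{- r..0}. 0 \<le> \<phi> s) \<longrightarrow>
           (\<exists>\<Phi>. is_maximal_solution \<alpha> f m g \<tau> r \<phi> \<infinity> \<Phi> \<and>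
                (\<exists>c>0. \<exists>\<nu>>0. \<forall>t\<ge>0.
                   norm (\<Phi> t) \<le> \<nu> * mittag_leffler \<beta> (- c * t powr \<beta>)))"
proof -
  have rd_le: "rd j \<le> r" if "j \<in> {1..m}" for j
    unfolding assms(4) by (rule Max_ge) (use that in auto)
  interpret cooperative_delay_system \<alpha> v f g m p r \<tau>
  proof
    have "1 \<in> {1..m}" using assms(1) by simp
    from assms(3)[OF this] rd_le[OF this] show "r \<ge> 0" by simp
    show "0 \<le> \<tau> j t \<and> \<tau> j t \<le> r" if "j \<in> {1..m}" "t \<ge> 0" for j t
      using assms(6)[OF that] rd_le[OF that(1)] by simp
    show "0 < v $ i" "(f v + (\<Sum>j=1..m. g j v)) $ i < 0" for i
      using assms(14,15) by (auto simp: vec_prec_def)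
  qed (use assms in auto)
  show ?thesis using \<gamma>_pos mittag_leffler_stable by blast
qed

end
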